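(* Let $m\ge n\ge2$ be integers and let $\Lambda\subseteq\{0,\ldots,m-1\}\times\{0,\ldots,n-1\}$ be nonempty. For every $z=(u,v)\in\mathbb{Z}^2$, $$d_\Lambda\le\dim_{\mathrm M}\mathcal{O}^+_\Lambda(z)\le\dim_{\mathrm{Be}}\mathcal{O}^+_\Lambda(z)\le\dim_{\mathrm B}K(\Lambda^{-1})\le s_{\mathrm{aff}}.$$ If $m=n$, all these quantities equal $\log_m\#\Lambda$.
   Context: **Maps and orbits.** $S_{(i,j)}(x,y)=(mx+i,ny+j)$ for $(i,j)\in\Lambda$, regarded as affine maps of $\mathbb{R}^2$. The forward orbit $\mathcal{O}^+_\Lambda(z)$ of $z\in\mathbb{Z}^2$ is the set of images of $z$ under all nonempty finite compositions of these maps. **Semigroup growth.** $G^*(\Lambda)$ is the semigroup generated by the maps $S_{(i,j)}$, $(i,j)\in\Lambda$, under composition, its elements being counted as distinct maps. For $g\in G^*(\Lambda)$ let $J_g$ be its linear part and $\|\cdot\|$ the Euclidean operator norm. Put $G_\Lambda(R)=\#\{g\in G^*(\Lambda):\|J_g\|\le R\}$ and $d_\Lambda=\lim_{R\to\infty}\frac{\log G_\Lambda(R)}{\log R}$ (this limit exists). **Orbit dimensions.** For $A\subseteq\mathbb{Z}^2$, $\dim_{\mathrm M}A=\lim_{h\to+\infty}\frac{\log\#(A\cap[-h,h]^2)}{\log h}$ (when the limit exists, as it does for these orbits), and $\dim_{\mathrm{Be}}A=\limsup_{h\to+\infty}\sup_{w\in\mathbb{R}^2}\frac{\log\#(A\cap(w+[-h,h]^2))}{\log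 h}$. **Dual system.** $K(\Lambda^{-1})$ is the attractor of the contractive IFS $\{S_{(i,j)}^{-1}\}_{(i,j)\in\Lambda}$ on $\mathbb{R}^2$, where $S_{(i,j)}^{-1}(x,y)=((x-i)/m,(y-j)/n)$; explicitly $K(\Lambda^{-1})=\{(-\sum_{\ell\ge1}i_\ell m^{-\ell},-\sum_{\ell\ge1}j_\ell n^{-\ell}):(i_\ell,j_\ell)\in\Lambda\}$. $\dim_{\mathrm B}$ is the usual box-counting dimension. **Affinity dimension.** Let $D=\mathrm{diag}(m,n)$, and for $0\le s\le2$ let $\varphi^s(D^{-1})=n^{-s}$ if $0\le s\le1$ and $\varphi^s(D^{-1})=n^{-1}m^{1-s}$ if $1\le s\le2$ (the singular value function). $s_{\mathrm{aff}}$ is the unique zero in $[0,2]$ of the singular value pressure $s\mapsto\log\#\Lambda+\log\varphi^s(D^{-1})$. *)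

theory Defs
  imports "HOL-Analysis.Analysis"
begin

text \<open>The plane is \<open>real \<times> real\<close>; its norm is the Euclidean one, so \<^const>\<open>onorm\<close> is the
  Euclidean operator norm.\<close>

definition S :: "nat \<Rightarrow> nat \<Rightarrow> nat \<times> nat \<Rightarrow> real \<times> real \<Rightarrow> real \<times> real" where
  "S m n = (\<lambda>(i, j) (x, y). (real m * x + real i, real n * y + real j))"

definition S_inv :: "nat \<Rightarrow> nat \<Rightarrow> nat \<times> nat \<Rightarrow> real \<times> real \<Rightarrow> real \<times> real" where
  "S_inv m n = (\<lambda>(i, j) (x, y). ((x - real i) / real m, (y - real j) / real n))"

lemma S_inv_eq_inv:
  assumes "m > 0" "n > 0"
  shows "S_inv m n p = inv (S m n p)"
  by (rule sym, rule inv_unique_comp)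
     (use assms in \<open>auto simp: fun_eq_iff S_def S_inv_def split: prod.splits\<close>)

inductive_set generated_semigroup :: "('a \<Rightarrow> 'a) set \<Rightarrow> ('a \<Rightarrow> 'a) set"
  for F :: "('a \<Rightarrow> 'a) set" where
  generator: "f \<in> F \<Longrightarrow> f \<in> generated_semigroup F"
| compose: "f \<in> generated_semigroup F \<Longrightarrow> g \<in> generated_semigroup F
    \<Longrightarrow> f \<circ> g \<in> generated_semigroup F"

definition G_star :: "nat \<Rightarrow> nat \<Rightarrow> (nat \<times> nat) set \<Rightarrow> (real \<times> real \<Rightarrow> real \<times> real) set" where
  "G_star m n \<Lambda> = generated_semigroup (S m n ` \<Lambda>)"

definition forward_orbit :: "nat \<Rightarrow> nat \<Rightarrow> (nat \<times> nat) set \<Rightarrow> real \<times> real \<Rightarrow> (real \<times> real) set" where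
  "forward_orbit m n \<Lambda> z = {g z | g. g \<in> G_star m n \<Lambda>}"

definition linear_part :: "('a::real_vector \<Rightarrow> 'b::real_vector) \<Rightarrow> 'a \<Rightarrow> 'b" where
  "linear_part g = (\<lambda>v. g v - g 0)"

definition growth_count :: "nat \<Rightarrow> nat \<Rightarrow> (nat \<times> nat) set \<Rightarrow> real \<Rightarrow> nat" where
  "growth_count m n \<Lambda> R = card {g \<in> G_star m n \<Lambda>. onorm (linear_part g) \<le> R}"

definition growth_quotient :: "nat \<Rightarrow> nat \<Rightarrow> (nat \<times> nat) set \<Rightarrow> real \<Rightarrow> real" where
  "growth_quotient m n \<Lambda> R = ln (real (growth_count m n \<Lambda> R)) / ln R"

text \<open>\<^const>\<open>Lim\<close> is meaningful only when the limit exists; the same applies to the other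
  dimensions defined through it below.\<close>

definition growth_dim :: "nat \<Rightarrow> nat \<Rightarrow> (nat \<times> nat) set \<Rightarrow> real" where
  "growth_dim m n \<Lambda> = Lim at_top (growth_quotient m n \<Lambda>)"

text \<open>The square \<open>w + [-h, h]\<^sup>2\<close>.\<close>

definition square :: "real \<times> real \<Rightarrow> real \<Rightarrow> (real \<times> real) set" where
  "square w h = cbox (w - (h, h)) (w + (h, h))"

text \<open>The following two dimensions are meant for nonempty \<open>A \<subseteq> \<int>\<^sup>2\<close>, for which every square meets
  \<open>A\<close> in a finite set. The value \<open>ln 0 = 0\<close> is then harmless: the count over \<open>square 0 h\<close> is
  positive for all large \<open>h\<close>, and a square centred at a point of \<open>A\<close> already makes the supremum
  over \<open>w\<close> nonnegative.\<close>

definition minkowski_quotient :: "(real \<times> real) set \<Rightarrow> real \<Rightarrow> real" where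
  "minkowski_quotient A h = ln (real (card (A \<inter> square 0 h))) / ln h"

definition minkowski_dim :: "(real \<times> real) set \<Rightarrow> real" where
  "minkowski_dim A = Lim at_top (minkowski_quotient A)"

definition beurling_dim :: "(real \<times> real) set \<Rightarrow> ereal" where
  "beurling_dim A = Limsup at_top
     (\<lambda>h::real. SUP w. ereal (ln (real (card (A \<inter> square w h))) / ln h))"

definition attractor :: "('a::metric_space \<Rightarrow> 'a) set \<Rightarrow> 'a set" where
  "attractor F = (THE K. compact K \<and> K \<noteq> {} \<and> K = (\<Union>f\<in>F. f ` K))"

definition K_dual :: "nat \<Rightarrow> nat \<Rightarrow> (nat \<times> nat) set \<Rightarrow> (real \<times> real) set" where
  "K_dual m n \<Lambda> = attractor (S_inv m n ` \<Lambda>)"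

text \<open>The number of closed squares of the \<open>\<delta>\<close>-mesh that meet \<open>F\<close>.\<close>

definition box_count :: "(real \<times> real) set \<Rightarrow> real \<Rightarrow> nat" where
  "box_count F \<delta> = card {(a :: int, b :: int).
     cbox (\<delta> * of_int a, \<delta> * of_int b) (\<delta> * (of_int a + 1), \<delta> * (of_int b + 1)) \<inter> F \<noteq> {}}"

definition box_quotient :: "(real \<times> real) set \<Rightarrow> real \<Rightarrow> real" where
  "box_quotient F \<delta> = ln (real (box_count F \<delta>)) / (- ln \<delta>)"

definition box_dim :: "(real \<times> real) set \<Rightarrow> real" where
  "box_dim F = Lim (at_right 0) (box_quotient F)"

text \<open>The singular value function of \<open>diag(m, n)\<^sup>-\<^sup>1\<close> for \<open>m \<ge> n\<close> and \<open>0 \<le> s \<le> 2\<close>.\<close>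

definition sv_fun :: "nat \<Rightarrow> nat \<Rightarrow> real \<Rightarrow> real" where
  "sv_fun m n s = (if s \<le> 1 then real n powr (- s) else inverse (real n) * real m powr (1 - s))"

definition sv_pressure :: "nat \<Rightarrow> nat \<Rightarrow> (nat \<times> nat) set \<Rightarrow> real \<Rightarrow> real" where
  "sv_pressure m n \<Lambda> s = ln (real (card \<Lambda>)) + ln (sv_fun m n s)"

definition s_aff :: "nat \<Rightarrow> nat \<Rightarrow> (nat \<times> nat) set \<Rightarrow> real" where
  "s_aff m n \<Lambda> = (THE s. 0 \<le> s \<and> s \<le> 2 \<and> sv_pressure m n \<Lambda> s = 0)"

end

theory Submission
  imports Defs "HOL-Real_Asymp.Real_Asymp"
begin

text \<open>Put \<open>N = #\<Lambda>\<close> and \<open>D(C) = log N / log m + log C (1 / log n - 1 / log m)\<close>. All the counting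
  functions turn out to be of order \<open>N\<^sup>p C\<^sup>q\<^sup>-\<^sup>p\<close> with \<open>p \<approx> log\<^sub>m h\<close> and \<open>q \<approx> log\<^sub>n h\<close>, up to a factor
  \<open>O(log h)\<close>: digit pairs are free in \<open>p\<close> places, and in the places between \<open>p\<close> and \<open>q\<close> only \<open>C\<close>
  second digits are available. For the semigroup growth \<open>C = 1\<close>; for the orbit \<open>C\<close> is the number of
  digits in the column of \<open>\<Lambda>\<close> over \<open>u mod m\<close> if \<open>u\<close> is \<open>0\<close> or \<open>-1\<close> (and this column is nonempty), and
  \<open>1\<close> otherwise; for the dual attractor, and as a bound for the orbit in windows of arbitrary
  centre, \<open>C\<close> is the number of nonempty rows. Monotonicity of \<open>D\<close> gives the chain, and
  \<open>C \<le> min(n, N)\<close> bounds the last value of \<open>D\<close> by the affinity dimension.\<close>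


section \<open>Discrete logarithms and approximate square counts\<close>

definition nat_log :: "nat \<Rightarrow> real \<Rightarrow> nat" where
  "nat_log b h = nat \<lfloor>log (real b) h\<rfloor>"

lemma nat_log_bounds:
  assumes "2 \<le> b" "1 \<le> h"
  shows "real (nat_log b h) \<le> log (real b) h" "log (real b) h < real (nat_log b h) + 1"
proof -
  have "0 \<le> log (real b) h"
    using assms by (simp add: zero_le_log_cancel_iff)
  then show "real (nat_log b h) \<le> log (real b) h" "log (real b) h < real (nat_log b h) + 1"
    unfolding nat_log_def by linarith+
qed

lemma power_nat_log_le:
  assumes "2 \<le> b" "1 \<le> h"
  shows "real b ^ nat_log b h \<le> h"
  using nat_log_bounds(1)[OF assms] assms
  by (simp add: le_log_iff flip: powr_realpow)

lemma less_power_Suc_nat_log: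
  assumes "2 \<le> b" "1 \<le> h"
  shows "h < real b ^ Suc (nat_log b h)"
proof -
  have "h < real b powr (real (nat_log b h) + 1)"
    using nat_log_bounds(2)[OF assms] assms by (simp add: log_less_iff)
  then show ?thesis
    using assms by (simp add: powr_add powr_realpow mult.commute)
qed

lemma le_nat_log_iff:
  assumes "2 \<le> b" "1 \<le> h"
  shows "k \<le> nat_log b h \<longleftrightarrow> real b ^ k \<le> h"
proof
  assume "k \<le> nat_log b h"
  then have "real b ^ k \<le> real b ^ nat_log b h"
    using assms by (intro power_increasing) auto
  with power_nat_log_le[OF assms] show "real b ^ k \<le> h" by linarith
next
  assume "real b ^ k \<le> h"
  with less_power_Suc_nat_log[OF assms] have "real b ^ k < real b ^ Suc (nat_log b h)"
    by linarith
  then show "k \<le> nat_log b h"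
    using assms by (subst (asm) power_strict_increasing_iff) auto
qed

lemma nat_log_antimono_base:
  assumes "2 \<le> n" "n \<le> m" "1 \<le> h"
  shows "nat_log m h \<le> nat_log n h"
proof -
  have "real n ^ nat_log m h \<le> real m ^ nat_log m h"
    using assms by (intro power_mono) auto
  also have "\<dots> \<le> h"
    using assms by (intro power_nat_log_le) auto
  finally show ?thesis
    using assms by (subst le_nat_log_iff) auto
qed

text \<open>The floor costs at most \<open>1\<close> and the factor \<open>c\<close> only adds
  \<open>ln c\<close>; both vanish after division by \<open>ln h\<close>. The factor is carried
  along because the orbit bounds evaluate counts at \<open>2 * h\<close> and at a fixed fraction of
  \<open>h\<close>.\<close>

lemma nat_log_tendsto:
  assumes "2 \<le> b" "0 < c"
  shows "((\<lambda>h. real (nat_log b (c * h)) / ln h) \<longlongrightarrow> 1 / ln (real b)) at_top"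
proof (rule tendsto_sandwich)
  have ev: "\<forall>\<^sub>F h in at_top. 1 \<le> c * h \<and> (1::real) < h"
    using assms by (intro eventually_conj; real_asymp)
  have b: "0 < ln (real b)" using assms by simp
  show "\<forall>\<^sub>F h in at_top. (ln (c * h) / ln (real b) - 1) / ln h \<le> real (nat_log b (c * h)) / ln h"
    using ev
  proof eventually_elim
    case (elim h)
    have "ln (c * h) / ln (real b) - 1 \<le> real (nat_log b (c * h))"
      using nat_log_bounds(2)[OF assms(1), of "c * h"] elim by (simp add: log_def)
    then show ?case
      using elim by (intro divide_right_mono) auto
  qed
  show "\<forall>\<^sub>F h in at_top. real (nat_log b (c * h)) / ln h \<le> ln (c * h) / ln (real b) / ln h"
    using ev
  proof eventually_elim
    case (elim h)
    have "real (nat_log b (c * h)) \<le> ln (c * h) / ln (real b)"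
      using nat_log_bounds(1)[OF assms(1), of "c * h"] elim by (simp add: log_def)
    then show ?case
      using elim by (intro divide_right_mono) auto
  qed
  show "((\<lambda>h. (ln (c * h) / ln (real b) - 1) / ln h) \<longlongrightarrow> 1 / ln (real b)) at_top"
    using assms b by real_asymp (simp add: divide_inverse)
  show "((\<lambda>h. ln (c * h) / ln (real b) / ln h) \<longlongrightarrow> 1 / ln (real b)) at_top"
    using assms b by real_asymp (simp add: divide_inverse)
qed

text \<open>The number of approximate squares of a Bedford-McMullen carpet at scale
  \<open>1 / h\<close>: width about \<open>1 / h\<close> takes \<open>nat_log m h\<close> digits,
  height about \<open>1 / h\<close> takes \<open>nat_log n h\<close>. The subtraction is genuine
  once \<open>1 \<le> h\<close> and \<open>2 \<le> n \<le> m\<close>.\<close>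

definition square_count :: "nat \<Rightarrow> nat \<Rightarrow> nat \<Rightarrow> nat \<Rightarrow> real \<Rightarrow> real" where
  "square_count m n N C h = real N ^ nat_log m h * real C ^ (nat_log n h - nat_log m h)"

text \<open>With \<open>C\<close> the number of nonempty rows this is McMullen's box dimension
  formula, log C / log n + log (N / C) / log m.\<close>

definition carpet_dim :: "nat \<Rightarrow> nat \<Rightarrow> nat \<Rightarrow> nat \<Rightarrow> real" where
  "carpet_dim m n N C =
     ln (real N) / ln (real m) + ln (real C) * (1 / ln (real n) - 1 / ln (real m))"

lemma carpet_dim_mono:
  assumes "2 \<le> n" "n \<le> m" "1 \<le> C" "C \<le> C'"
  shows "carpet_dim m n N C \<le> carpet_dim m n N C'"
proof -
  have "1 / ln (real m) \<le> 1 / ln (real n)"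
    using assms by (intro divide_left_mono) auto
  moreover have "ln (real C) \<le> ln (real C')"
    using assms by simp
  ultimately show ?thesis
    unfolding carpet_dim_def by (intro add_left_mono mult_right_mono) auto
qed

lemma square_count_pos:
  assumes "1 \<le> N" "1 \<le> C"
  shows "0 < square_count m n N C h"
  using assms by (simp add: square_count_def)

lemma ln_square_count_tendsto:
  assumes "2 \<le> n" "n \<le> m" "1 \<le> N" "1 \<le> C" "0 < c"
  shows "((\<lambda>h. ln (square_count m n N C (c * h)) / ln h) \<longlongrightarrow> carpet_dim m n N C) at_top"
proof -
  let ?p = "\<lambda>h. real (nat_log m (c * h)) / ln h" and ?q = "\<lambda>h. real (nat_log n (c * h)) / ln h"
  have "((\<lambda>h. ln (real N) * ?p h + ln (real C) * (?q h - ?p h)) \<longlongrightarrow>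
      ln (real N) * (1 / ln (real m)) + ln (real C) * (1 / ln (real n) - 1 / ln (real m))) at_top"
    using assms by (intro tendsto_intros nat_log_tendsto) auto
  then have lim: "((\<lambda>h. ln (real N) * ?p h + ln (real C) * (?q h - ?p h)) \<longlongrightarrow>
      carpet_dim m n N C) at_top"
    by (simp add: carpet_dim_def)
  have "\<forall>\<^sub>F h in at_top. 1 \<le> c * h"
    using assms by real_asymp
  then have "\<forall>\<^sub>F h in at_top. ln (real N) * ?p h + ln (real C) * (?q h - ?p h) =
      ln (square_count m n N C (c * h)) / ln h"
  proof eventually_elim
    case (elim h)
    have "nat_log m (c * h) \<le> nat_log n (c * h)"
      using nat_log_antimono_base assms elim by blast
    then have eq: "ln (square_count m n N C (c * h)) = real (nat_log m (c * h)) * ln (real N) +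
        (real (nat_log n (c * h)) - real (nat_log m (c * h))) * ln (real C)"
      using assms by (simp add: square_count_def ln_mult ln_realpow of_nat_diff)
    show ?case
      by (simp add: eq add_divide_distrib diff_divide_distrib algebra_simps)
  qed
  then show ?thesis
    by (rule Lim_transform_eventually[OF lim])
qed

text \<open>The extra factor, which will count word lengths, is logarithmic in \<open>h\<close>, so
  it contributes only a term of order log log h / log h.\<close>

lemma ln_upper_bound_tendsto:
  assumes "2 \<le> n" "n \<le> m" "1 \<le> N" "1 \<le> C" "0 < c" "0 < A"
  shows "((\<lambda>h. ln (A * (1 + real (nat_log n (c * h))) * square_count m n N C (c * h)) / ln h)
    \<longlongrightarrow> carpet_dim m n N C) at_top"
proof -
  have ev: "\<forall>\<^sub>F h in at_top. 1 \<le> c * h \<and> (1::real) < h"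
    using assms by (intro eventually_conj; real_asymp)
  have n: "0 < ln (real n)" using assms by simp
  have A: "((\<lambda>h. ln A / ln h) \<longlongrightarrow> 0) at_top"
    by real_asymp
  have L: "((\<lambda>h. ln (1 + real (nat_log n (c * h))) / ln h) \<longlongrightarrow> 0) at_top"
  proof (rule tendsto_sandwich)
    show "\<forall>\<^sub>F h in at_top. 0 \<le> ln (1 + real (nat_log n (c * h))) / ln h"
      using ev by eventually_elim simp
    show "\<forall>\<^sub>F h in at_top. ln (1 + real (nat_log n (c * h))) / ln h
        \<le> ln (1 + ln (c * h) / ln (real n)) / ln h"
      using ev
    proof eventually_elim
      case (elim h)
      have "real (nat_log n (c * h)) \<le> ln (c * h) / ln (real n)"
        using nat_log_bounds(1)[OF assms(1), of "c * h"] elim by (simp add: log_def)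
      then show ?case
        using elim by (intro divide_right_mono) auto
    qed
    show "((\<lambda>h. ln (1 + ln (c * h) / ln (real n)) / ln h) \<longlongrightarrow> 0) at_top"
      using assms(5) n by real_asymp
  qed simp
  have "((\<lambda>h. ln A / ln h + ln (1 + real (nat_log n (c * h))) / ln h
      + ln (square_count m n N C (c * h)) / ln h) \<longlongrightarrow> 0 + 0 + carpet_dim m n N C) at_top"
    using assms by (intro tendsto_add A L ln_square_count_tendsto)
  moreover have "ln (A * (1 + real (nat_log n (c * h))) * square_count m n N C (c * h)) / ln h =
      ln A / ln h + ln (1 + real (nat_log n (c * h))) / ln h
      + ln (square_count m n N C (c * h)) / ln h" for h
  proof -
    have "ln (A * (1 + real (nat_log n (c * h))) * square_count m n N C (c * h)) =
      ln A + ln (1 + real (nat_log n (c * h))) + ln (square_count m n N C (c * h))"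
      using assms square_count_pos[of N C m n "c * h"]
      by (subst ln_mult; simp add: ln_mult add_pos_nonneg)
    then show ?thesis by (simp add: add_divide_distrib)
  qed
  ultimately show ?thesis by simp
qed

text \<open>Raising both exponents by one leaves their difference unchanged, so replacing the
  largest powers below \<open>h\<close> by the next ones above costs just a factor
  \<open>N\<close>.\<close>

lemma square_count_Suc:
  "real N ^ Suc (nat_log m h) * real C ^ (Suc (nat_log n h) - Suc (nat_log m h))
    = real N * square_count m n N C h"
  by (simp add: square_count_def)

text \<open>The common last step for the semigroup, the orbit and the attractor: constants,
  rescalings of \<open>h\<close> and a logarithmic factor do not change the growth exponent.\<close>

lemma ln_count_tendsto:
  fixes f :: "real \<Rightarrow> nat"
  assumes "2 \<le> n" "n \<le> m" "1 \<le> N" "1 \<le> C" "0 < c" "0 < d" "0 < a" "0 < A"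
    and lower: "\<forall>\<^sub>F h in at_top. a * square_count m n N C (c * h) \<le> real (f h)"
    and upper: "\<forall>\<^sub>F h in at_top.
      real (f h) \<le> A * (1 + real (nat_log n (d * h))) * square_count m n N C (d * h)"
  shows "((\<lambda>h. ln (real (f h)) / ln h) \<longlongrightarrow> carpet_dim m n N C) at_top"
proof (rule tendsto_sandwich)
  have gt: "\<forall>\<^sub>F h in at_top. (1::real) < h" by real_asymp
  have A: "((\<lambda>h. ln a / ln h) \<longlongrightarrow> 0) at_top"
    by real_asymp
  have "((\<lambda>h. ln a / ln h + ln (square_count m n N C (c * h)) / ln h)
      \<longlongrightarrow> 0 + carpet_dim m n N C) at_top"
    using assms by (intro tendsto_add A ln_square_count_tendsto)
  moreover have "ln (a * square_count m n N C (c * h)) / ln h =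
      ln a / ln h + ln (square_count m n N C (c * h)) / ln h" for h
    using assms square_count_pos[of N C m n "c * h"] by (simp add: ln_mult add_divide_distrib)
  ultimately show
    "((\<lambda>h. ln (a * square_count m n N C (c * h)) / ln h) \<longlongrightarrow> carpet_dim m n N C) at_top"
    by simp
  show "((\<lambda>h. ln (A * (1 + real (nat_log n (d * h))) * square_count m n N C (d * h)) / ln h)
    \<longlongrightarrow> carpet_dim m n N C) at_top"
    using assms by (intro ln_upper_bound_tendsto)
  show "\<forall>\<^sub>F h in at_top. ln (a * square_count m n N C (c * h)) / ln h \<le> ln (real (f h)) / ln h"
    using lower gt
  proof eventually_elim
    case (elim h)
    then show ?case
      using assms square_count_pos[of N C m n "c * h"]
      by (intro divide_right_mono) (auto intro!: ln_mono)
  qed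
  show "\<forall>\<^sub>F h in at_top. ln (real (f h)) / ln h
      \<le> ln (A * (1 + real (nat_log n (d * h))) * square_count m n N C (d * h)) / ln h"
    using lower upper gt
  proof eventually_elim
    case (elim h)
    \<comment> \<open>Positivity comes from the lower bound; it excludes the default value of
      \<open>ln\<close> at \<open>0\<close>.\<close>
    have "0 < real (f h)"
      using elim assms square_count_pos[of N C m n "c * h"] by (smt (verit) mult_pos_pos)
    then show ?case
      using elim by (intro divide_right_mono ln_mono) auto
  qed
qed

section \<open>Digit expansions\<close>

abbreviation digit_value :: "nat \<Rightarrow> nat list \<Rightarrow> int" where
  "digit_value b ds \<equiv> horner_sum int (int b) ds"

lemma digit_value_nonneg: "0 \<le> digit_value b ds"
  by (induction ds) auto

lemma digit_value_less:
  assumes "set ds \<subseteq> {..<b}"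
  shows "digit_value b ds < int b ^ length ds"
  using assms
proof (induction ds)
  case (Cons d ds)
  have "digit_value b (d # ds) < int b + int b * digit_value b ds"
    using Cons.prems by simp
  also have "\<dots> = int b * (digit_value b ds + 1)"
    by (simp add: algebra_simps)
  also have "\<dots> \<le> int b * int b ^ length ds"
    using Cons by (intro mult_left_mono) auto
  finally show ?case by simp
qed simp

text \<open>The head of the list is the least significant digit, hence the residue modulo
  \<open>b\<close>; the induction peels it off.\<close>

lemma digit_value_inj:
  assumes "length ds = length es" "set ds \<subseteq> {..<b}" "set es \<subseteq> {..<b}"
    and "digit_value b ds = digit_value b es"
  shows "ds = es"
  using assms
proof (induction ds es rule: list_induct2)
  case (Cons d ds e es)
  have b: "0 < int b" using Cons.prems by auto
  have "(int d + int b * digit_value b ds) mod int b = (int e + int b * digit_value b es) mod int b"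
    using Cons.prems by simp
  then have "d = e"
    using Cons.prems by simp
  then show ?case
    using Cons b by simp
qed simp

text \<open>One coordinate of a word acting on an integer: the maps t -> d + b t for
  \<open>d\<close> in \<open>ds\<close> are composed with the head outermost and applied to
  \<open>x\<close>.\<close>

definition expand :: "nat \<Rightarrow> nat list \<Rightarrow> int \<Rightarrow> int" where
  "expand b ds x = digit_value b ds + int b ^ length ds * x"

lemma expand_Nil [simp]: "expand b [] x = x"
  and expand_Cons [simp]: "expand b (d # ds) x = int d + int b * expand b ds x"
  by (simp_all add: expand_def algebra_simps)

lemma expand_append: "expand b (ds @ es) x = expand b ds (expand b es x)"
  by (induction ds) auto

lemma abs_expand_le:
  assumes "set ds \<subseteq> {..<b}"
  shows "\<bar>expand b ds x\<bar> \<le> int b ^ length ds * (\<bar>x\<bar> + 1)"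
proof -
  have "\<bar>expand b ds x\<bar> \<le> digit_value b ds + \<bar>int b ^ length ds * x\<bar>"
    using digit_value_nonneg[of b ds] by (simp add: expand_def)
  also have "\<dots> \<le> int b ^ length ds + int b ^ length ds * \<bar>x\<bar>"
    using digit_value_less[OF assms] by (simp add: abs_mult)
  finally show ?thesis by (simp add: algebra_simps)
qed

text \<open>\<open>0\<close> and \<open>-1\<close> are the integers fixed by \<open>\<lambda>x. x div b\<close>; they are the only starting points
  whose long expansions can stay bounded, and this forces every digit.\<close>

lemma expand_in_0_minus_1:
  assumes "expand b ds x = e" "e = 0 \<or> e = -1" "set ds \<subseteq> {..<b}"
  shows "x = e \<and> set ds \<subseteq> {nat (e mod int b)}"
  using assms(1,3)
proof (induction ds)
  case (Cons d ds)
  have d: "d < b" using Cons.prems by simp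
  have e: "int d + int b * expand b ds x = e" using Cons.prems by simp
  \<comment> \<open>Division with remainder by \<open>b\<close> separates the head digit from the
    rest of the expansion, and \<open>e\<close> is its own quotient.\<close>
  have "e div int b = expand b ds x" "e mod int b = int d"
    using d by (simp_all flip: e)
  moreover have "e div int b = e"
    using assms(2) d by (auto simp: zmod_minus1 div_eq_minus1)
  ultimately show ?case
    using Cons by auto
qed simp

text \<open>Conversely, the forced digit (\<open>0\<close> for \<open>e = 0\<close>,
  \<open>b - 1\<close> for \<open>e = -1\<close>) fixes \<open>e\<close>, as in (b - 1) + b (-1) =
  -1. This yields long words that do not move the first coordinate.\<close>

lemma expand_replicate:
  assumes "0 < b" "e = 0 \<or> e = -1"
  shows "expand b (replicate k (nat (e mod int b))) e = e"
proof -
  have "e div int b = e"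
    using assms by (auto simp: div_eq_minus1)
  then have "e mod int b + int b * e = e"
    by (metis mod_mult_div_eq)
  then show ?thesis
    using assms by (induction k) auto
qed

section \<open>Attractors\<close>

text \<open>Pull a point of \<open>K\<close> back \<open>k\<close> times inside \<open>K\<close> and
  apply the same maps to a point of \<open>L\<close>: the distance shrinks by \<open>c ^ k\<close>,
  so the point lies in the closure of \<open>L\<close>. Exchanging the roles of \<open>K\<close> and
  \<open>L\<close> gives uniqueness of the attractor.\<close>

lemma invariant_compact_subset:
  fixes F :: "('a::metric_space \<Rightarrow> 'a) set"
  assumes "0 \<le> c" "c < 1"
    and lip: "\<And>f x y. f \<in> F \<Longrightarrow> dist (f x) (f y) \<le> c * dist x y"
    and K: "compact K" "K \<noteq> {}" "K = (\<Union>f\<in>F. f ` K)"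
    and L: "compact L" "L \<noteq> {}" "L = (\<Union>f\<in>F. f ` L)"
  shows "K \<subseteq> L"
proof
  obtain y where y: "y \<in> L" using L by blast
  obtain r where r: "dist x y \<le> r" if "x \<in> K" for x
    using compact_imp_bounded[OF K(1)] unfolding bounded_any_center[where a = y]
    by (auto simp: dist_commute)
  have near: "\<exists>z\<in>L. dist x z \<le> c ^ k * r" if "x \<in> K" for x k
    using that
  proof (induction k arbitrary: x)
    case 0
    then show ?case using r y by auto
  next
    case (Suc k)
    from Suc.prems K(3) obtain f x' where x': "f \<in> F" "x' \<in> K" "x = f x'" by blast
    from Suc.IH[OF x'(2)] obtain z where z: "z \<in> L" "dist x' z \<le> c ^ k * r" by blast
    have "f z \<in> L" using L(3) z x' by blast
    moreover have "dist x (f z) \<le> c * (c ^ k * r)"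
      unfolding x'(3) using lip[OF x'(1), of x' z] mult_left_mono[OF z(2) assms(1)] by linarith
    ultimately show ?case by (auto simp: mult.assoc)
  qed
  fix x assume x: "x \<in> K"
  have "\<exists>z\<in>L. dist z x < e" if "0 < e" for e
  proof -
    have "(\<lambda>k. c ^ k * r) \<longlonglongrightarrow> 0 * r"
      using assms by (intro tendsto_mult LIMSEQ_realpow_zero tendsto_const) auto
    then have "\<forall>\<^sub>F k in sequentially. c ^ k * r < e"
      using that by (intro order_tendstoD(2)) auto
    then obtain k where "c ^ k * r < e"
      by (meson eventually_happens trivial_limit_sequentially)
    with near[OF x, of k] show ?thesis
      by (metis dist_commute order_le_less_trans)
  qed
  then have "x \<in> closure L" by (simp add: closure_approachable)
  then show "x \<in> L" using compact_imp_closed[OF L(1)] by simp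
qed

text \<open>The iterates of \<open>B\<close> under the Hutchinson operator \<open>H\<close>
  decrease, and their intersection is the invariant set. Injectivity serves to interchange this
  intersection with the images.\<close>

lemma invariant_compact_exists:
  fixes F :: "('a::heine_borel \<Rightarrow> 'a) set"
  assumes F: "finite F" "F \<noteq> {}"
    and cont: "\<And>f. f \<in> F \<Longrightarrow> continuous_on UNIV f"
    and inj: "\<And>f. f \<in> F \<Longrightarrow> inj f"
    and B: "compact B" "B \<noteq> {}" "\<And>f. f \<in> F \<Longrightarrow> f ` B \<subseteq> B"
  shows "\<exists>K. compact K \<and> K \<noteq> {} \<and> K \<subseteq> B \<and> K = (\<Union>f\<in>F. f ` K)"
proof -
  define H where "H A = (\<Union>f\<in>F. f ` A)" for A
  define X where "X k = (H ^^ k) B" for k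
  have X_Suc: "X (Suc k) = (\<Union>f\<in>F. f ` X k)" for k
    by (simp add: X_def H_def)
  have comp: "compact (X k)" for k
  proof (induction k)
    case (Suc k)
    then show ?case
      unfolding X_Suc using F cont
      by (intro compact_UN compact_continuous_image) (auto intro: continuous_on_subset)
  qed (simp add: X_def B)
  have ne: "X k \<noteq> {}" for k
  proof (induction k)
    case (Suc k)
    then show ?case
      unfolding X_Suc using F by blast
  qed (simp add: X_def B)
  have dec: "X (Suc k) \<subseteq> X k" for k
  proof (induction k)
    case 0
    then show ?case unfolding X_Suc using B(3) by (force simp: X_def)
  next
    case (Suc k)
    then show ?case unfolding X_Suc[of "Suc k"] X_Suc[of k] by blast
  qed
  have anti: "X l \<subseteq> X k" if "k \<le> l" for k l
    using that dec by (rule lift_Suc_antimono_le[rotated])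
  define K where "K = (\<Inter>k. X k)"
  have "compact K"
    unfolding K_def using comp by (intro compact_Inter) auto
  moreover have "K \<noteq> {}"
    unfolding K_def using comp ne anti by (intro compact_nest) auto
  moreover have "K \<subseteq> B"
    using INT_lower[of 0 UNIV X] by (simp add: K_def X_def)
  moreover have "K = (\<Union>f\<in>F. f ` K)"
  proof
    show "(\<Union>f\<in>F. f ` K) \<subseteq> K"
    proof clarsimp
      fix f x assume f: "f \<in> F" and x: "x \<in> K"
      have "f x \<in> X (Suc k)" for k
        unfolding X_Suc using f x by (auto simp: K_def)
      then show "f x \<in> K"
        unfolding K_def using dec by blast
    qed
    show "K \<subseteq> (\<Union>f\<in>F. f ` K)"
    proof
      fix x assume x: "x \<in> K"
      have "\<exists>f\<in>F. x \<in> f ` X k" for k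
        using x X_Suc[of k] unfolding K_def by blast
      then obtain g where g: "\<And>k. g k \<in> F" "\<And>k. x \<in> g k ` X k"
        by metis
      \<comment> \<open>As \<open>F\<close> is finite, one map works for infinitely many levels, and
        by monotonicity of \<open>X\<close> then for all of them.\<close>
      obtain f where f: "infinite {k. g k = f}" "f \<in> F"
        using pigeonhole_infinite[of "UNIV :: nat set" g] F g(1)
        by (smt (verit, best) Collect_cong finite_subset image_subset_iff infinite_UNIV_nat UNIV_I)
      have img: "x \<in> f ` X k" for k
      proof -
        obtain l where "k \<le> l" "g l = f"
          using f(1) by (metis (mono_tags, lifting) infinite_nat_iff_unbounded_le mem_Collect_eq)
        with g(2)[of l] anti show ?thesis by blast
      qed
      then obtain y where y: "x = f y" by blast
      \<comment> \<open>By injectivity the preimage of \<open>x\<close> under \<open>f\<close> is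
        the same at every level.\<close>
      have "y \<in> X k" for k
        using img[of k] y inj[OF f(2)] by (auto dest: injD)
      then show "x \<in> (\<Union>f\<in>F. f ` K)"
        using y f(2) by (auto simp: K_def)
    qed
  qed
  ultimately show ?thesis by blast
qed


section \<open>Words\<close>

text \<open>The first letter is the outermost map, so it supplies the least significant digit of
  both translation parts.\<close>

definition word_map :: "nat \<Rightarrow> nat \<Rightarrow> (nat \<times> nat) list \<Rightarrow> real \<times> real \<Rightarrow> real \<times> real" where
  "word_map m n w = foldr (\<lambda>d g. S m n d \<circ> g) w id"

lemma word_map_Nil [simp]: "word_map m n [] = id"
  and word_map_Cons [simp]: "word_map m n (d # w) = S m n d \<circ> word_map m n w"
  by (simp_all add: word_map_def)

lemma word_map_append: "word_map m n (v @ w) = word_map m n v \<circ> word_map m n w"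
  by (induction v) (auto simp: comp_assoc)

lemma word_map_apply:
  "word_map m n w (x, y) =
    (real m ^ length w * x + of_int (digit_value m (map fst w)),
     real n ^ length w * y + of_int (digit_value n (map snd w)))"
  by (induction w) (auto simp: S_def algebra_simps)

lemma word_map_of_int:
  "word_map m n w (of_int u, of_int v) =
    (of_int (expand m (map fst w) u), of_int (expand n (map snd w) v))"
  by (simp add: word_map_apply expand_def)

definition lists_of :: "'a set \<Rightarrow> nat \<Rightarrow> 'a list set" where
  "lists_of A k = {w. set w \<subseteq> A \<and> length w = k}"

lemma finite_lists_of: "finite A \<Longrightarrow> finite (lists_of A k)"
  by (simp add: lists_of_def finite_lists_length_eq)

lemma card_lists_of: "finite A \<Longrightarrow> card (lists_of A k) = card A ^ k"
  by (simp add: lists_of_def card_lists_length_eq)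

lemma G_star_eq: "G_star m n \<Lambda> = word_map m n ` {w. set w \<subseteq> \<Lambda> \<and> w \<noteq> []}"
proof
  show "G_star m n \<Lambda> \<subseteq> word_map m n ` {w. set w \<subseteq> \<Lambda> \<and> w \<noteq> []}"
  proof
    fix g assume "g \<in> G_star m n \<Lambda>"
    then show "g \<in> word_map m n ` {w. set w \<subseteq> \<Lambda> \<and> w \<noteq> []}"
      unfolding G_star_def
    proof induction
      case (generator f)
      then obtain d where "d \<in> \<Lambda>" "f = S m n d" by blast
      then show ?case by (intro image_eqI[where x = "[d]"]) auto
    next
      case (compose f g)
      then obtain v w where "f = word_map m n v" "set v \<subseteq> \<Lambda>" "v \<noteq> []"
        "g = word_map m n w" "set w \<subseteq> \<Lambda>" by blast
      then show ?case
        by (intro image_eqI[where x = "v @ w"]) (auto simp: word_map_append)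
    qed
  qed
  have "word_map m n w \<in> G_star m n \<Lambda>" if "set w \<subseteq> \<Lambda>" "w \<noteq> []" for w
    using that(2,1)
  proof (induction w rule: list_nonempty_induct)
    case (single d)
    then show ?case by (auto simp: G_star_def intro: generated_semigroup.generator)
  next
    case (cons d w)
    then show ?case
      unfolding G_star_def word_map_Cons
      by (intro generated_semigroup.compose[OF generated_semigroup.generator]) auto
  qed
  then show "word_map m n ` {w. set w \<subseteq> \<Lambda> \<and> w \<noteq> []} \<subseteq> G_star m n \<Lambda>" by blast
qed

lemma forward_orbit_eq:
  "forward_orbit m n \<Lambda> z = (\<lambda>w. word_map m n w z) ` {w. set w \<subseteq> \<Lambda> \<and> w \<noteq> []}"
  unfolding forward_orbit_def G_star_eq by blast

text \<open>The linear part is diagonal with entries \<open>m ^ k\<close> and \<open>n ^ k\<close>,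
  \<open>k\<close> the word length; since \<open>n \<le> m\<close> its norm is attained at
  \<open>(1, 0)\<close>. A bound on the norm is therefore a bound on word length.\<close>

lemma onorm_linear_part_word_map:
  assumes "n \<le> m"
  shows "onorm (linear_part (word_map m n w)) = real m ^ length w"
proof (rule antisym)
  let ?k = "length w"
  have lin: "linear_part (word_map m n w) (x, y) = (real m ^ ?k * x, real n ^ ?k * y)" for x y
    by (simp add: linear_part_def word_map_apply zero_prod_def)
  have "norm (linear_part (word_map m n w) z) \<le> real m ^ ?k * norm z" for z
  proof (cases z)
    case (Pair x y)
    have "norm (real n ^ ?k * y) \<le> norm (real m ^ ?k * y)"
      using assms by (simp add: abs_mult mult_right_mono power_mono)
    then have "norm (linear_part (word_map m n w) z) \<le> norm (real m ^ ?k * x, real m ^ ?k * y)"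
      unfolding Pair lin norm_Pair
      by (intro real_sqrt_le_mono add_left_mono power_mono) auto
    also have "\<dots> = norm (real m ^ ?k *\<^sub>R z)"
      by (simp add: Pair)
    finally show ?thesis by simp
  qed
  then show "onorm (linear_part (word_map m n w)) \<le> real m ^ ?k"
    by (rule onorm_le)
  have "linear_part (word_map m n w) = (\<lambda>z. (real m ^ ?k * fst z, real n ^ ?k * snd z))"
    using lin by (auto simp: fun_eq_iff)
  then have "bounded_linear (linear_part (word_map m n w))"
    by (auto intro!: bounded_linear_Pair bounded_linear_const_mult bounded_linear_fst bounded_linear_snd)
  then show "real m ^ ?k \<le> onorm (linear_part (word_map m n w))"
    using le_onorm[of _ "(1, 0)"] by (force simp: lin norm_Pair)
qed

text \<open>Whenever a grid cell meets a window or a cell that is no longer than it, its index is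
  confined to an interval of length \<open>2\<close>; this gives the factor \<open>3\<close> per
  coordinate in all later counts.\<close>

lemma card_int_interval_le:
  "finite {x::int. t - 2 \<le> real_of_int x \<and> real_of_int x \<le> t}"
  "card {x::int. t - 2 \<le> real_of_int x \<and> real_of_int x \<le> t} \<le> 3"
proof -
  have sub: "{x::int. t - 2 \<le> real_of_int x \<and> real_of_int x \<le> t} \<subseteq> {\<lfloor>t\<rfloor> - 2..\<lfloor>t\<rfloor>}"
    by (auto simp: le_floor_iff) linarith
  then show "finite {x::int. t - 2 \<le> real_of_int x \<and> real_of_int x \<le> t}"
    by (rule finite_subset) simp
  show "card {x::int. t - 2 \<le> real_of_int x \<and> real_of_int x \<le> t} \<le> 3"
    using card_mono[OF _ sub] by simp
qed

lemma square_iff: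
  "(x, y) \<in> square (a, b) h \<longleftrightarrow> a - h \<le> x \<and> x \<le> a + h \<and> b - h \<le> y \<and> y \<le> b + h"
  by (auto simp: square_def cbox_Pair_eq)

section \<open>Digit systems and unique coding by words of fixed length\<close>

locale digit_system =
  fixes m n :: nat and \<Lambda> :: "(nat \<times> nat) set"
  assumes n_ge_2: "2 \<le> n" and n_le_m: "n \<le> m"
    and digits: "\<Lambda> \<subseteq> {0..<m} \<times> {0..<n}" and nonempty: "\<Lambda> \<noteq> {}"
begin

lemma m_ge_2: "2 \<le> m"
  using n_ge_2 n_le_m by simp

lemma finite_Lambda: "finite \<Lambda>"
  using digits by (rule finite_subset) simp

lemma card_Lambda_ge_1: "1 \<le> card \<Lambda>"
  using finite_Lambda nonempty by (simp add: Suc_le_eq card_gt_0_iff)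

lemma card_rows_ge_1: "1 \<le> card (snd ` \<Lambda>)"
  using finite_Lambda nonempty by (simp add: Suc_le_eq card_gt_0_iff)

lemma fst_digits: "set w \<subseteq> \<Lambda> \<Longrightarrow> set (map fst w) \<subseteq> {..<m}"
  and snd_digits: "set w \<subseteq> \<Lambda> \<Longrightarrow> set (map snd w) \<subseteq> {..<n}"
  using digits by fastforce+

text \<open>Words of equal length have the same linear part, so agreement at a single point already
  forces equal translation parts, and digit expansions of fixed length are unique.\<close>

lemma word_map_inj:
  assumes "v \<in> lists_of \<Lambda> k" "w \<in> lists_of \<Lambda> k" "word_map m n v z = word_map m n w z"
  shows "v = w"
proof -
  have *: "length v = length w" "set v \<subseteq> \<Lambda>" "set w \<subseteq> \<Lambda>"
    using assms by (auto simp: lists_of_def)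
  have "digit_value m (map fst v) = digit_value m (map fst w)"
    "digit_value n (map snd v) = digit_value n (map snd w)"
    using assms(3) *(1) by (cases z; simp add: word_map_apply)+
  then have "map fst v = map fst w" "map snd v = map snd w"
    using digit_value_inj[of "map fst v" "map fst w" m] digit_value_inj[of "map snd v" "map snd w" n]
      fst_digits[of v] fst_digits[of w] snd_digits[of v] snd_digits[of w] *
    by (simp_all del: set_map)
  then show ?thesis
    by (metis zip_map_fst_snd)
qed

lemma card_word_map_image: "card ((\<lambda>w. word_map m n w z) ` lists_of \<Lambda> k) = card \<Lambda> ^ k"
  using word_map_inj by (subst card_image) (auto simp: inj_on_def card_lists_of finite_Lambda)

section \<open>Growth of the semigroup\<close>

lemma growth_count_bounds:
  assumes "real m \<le> R"
  shows "card \<Lambda> ^ nat_log m R \<le> growth_count m n \<Lambda> R"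
    and "growth_count m n \<Lambda> R \<le> nat_log m R * card \<Lambda> ^ nat_log m R"
proof -
  let ?p = "nat_log m R"
  have R: "1 \<le> R" using assms m_ge_2 by simp
  have p: "1 \<le> ?p" using le_nat_log_iff[OF m_ge_2 R, of 1] assms by simp
  have eq: "{g \<in> G_star m n \<Lambda>. onorm (linear_part g) \<le> R} =
    (\<Union>k\<in>{1..?p}. word_map m n ` lists_of \<Lambda> k)" (is "?G = _")
    unfolding G_star_eq lists_of_def
    by (fastforce simp: onorm_linear_part_word_map n_le_m le_nat_log_iff[OF m_ge_2 R, symmetric] Suc_le_eq)
  have fin: "finite ?G"
    unfolding eq by (auto intro: finite_lists_of finite_Lambda)
  have card: "card (word_map m n ` lists_of \<Lambda> k) = card \<Lambda> ^ k" for k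
    using word_map_inj
    by (subst card_image) (auto simp: inj_on_def card_lists_of finite_Lambda)
  have "card \<Lambda> ^ ?p = card (word_map m n ` lists_of \<Lambda> ?p)"
    by (simp add: card)
  also have "\<dots> \<le> card ?G"
    using p by (intro card_mono[OF fin]) (auto simp: eq)
  finally show "card \<Lambda> ^ ?p \<le> growth_count m n \<Lambda> R"
    by (simp add: growth_count_def)
  have "card ?G \<le> (\<Sum>k\<in>{1..?p}. card (word_map m n ` lists_of \<Lambda> k))"
    unfolding eq by (rule card_UN_le) simp
  also have "\<dots> \<le> (\<Sum>k\<in>{1..?p}. card \<Lambda> ^ ?p)"
    using card_Lambda_ge_1 by (intro sum_mono) (auto simp: card intro!: power_increasing)
  finally show "growth_count m n \<Lambda> R \<le> ?p * card \<Lambda> ^ ?p"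
    by (simp add: growth_count_def)
qed

lemma growth_quotient_tendsto:
  "(growth_quotient m n \<Lambda> \<longlongrightarrow> carpet_dim m n (card \<Lambda>) 1) at_top"
  unfolding growth_quotient_def
proof (rule ln_count_tendsto[where a = 1 and A = 1 and c = 1 and d = 1])
  show "\<forall>\<^sub>F R in at_top. 1 * square_count m n (card \<Lambda>) 1 (1 * R) \<le> real (growth_count m n \<Lambda> R)"
    using eventually_ge_at_top[of "real m"]
  proof eventually_elim
    case (elim R)
    show ?case
      using of_nat_mono[OF growth_count_bounds(1)[OF elim], where 'a = real]
      by (simp add: square_count_def)
  qed
  show "\<forall>\<^sub>F R in at_top. real (growth_count m n \<Lambda> R)
      \<le> 1 * (1 + real (nat_log n (1 * R))) * square_count m n (card \<Lambda>) 1 (1 * R)"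
    using eventually_ge_at_top[of "real m"]
  proof eventually_elim
    case (elim R)
    have "nat_log m R \<le> nat_log n R"
      using elim m_ge_2 n_ge_2 n_le_m by (intro nat_log_antimono_base) auto
    then have "real (nat_log m R) * real (card \<Lambda>) ^ nat_log m R
        \<le> (1 + real (nat_log n R)) * real (card \<Lambda>) ^ nat_log m R"
      by (intro mult_right_mono) auto
    then show ?case
      using of_nat_mono[OF growth_count_bounds(2)[OF elim], where 'a = real]
      by (simp add: square_count_def)
  qed
qed (use n_ge_2 n_le_m card_Lambda_ge_1 in auto)

end


context digit_system
begin

section \<open>Counting orbit points in a window\<close>

text \<open>Within the window a point is determined, up to boundedly many choices of tail values, by
  its first \<open>p\<close> letters and the second digits at the places from \<open>p\<close> to
  \<open>q\<close>, which must lie in \<open>F\<close>. Words of length at most \<open>p\<close>,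
  between \<open>p\<close> and \<open>q\<close>, and beyond \<open>q\<close> are counted separately,
  giving \<open>(q + 1) + 3 * (q + 1) + 9 = 13 + 4 * q\<close>.\<close>

lemma orbit_window_card_le:
  fixes u v :: int and F :: "nat set" and a b h :: real
  defines "pt \<equiv> \<lambda>w. word_map m n w (of_int u, of_int v)"
  assumes pq: "p \<le> q" and p: "2 * h < real m ^ p" and q: "2 * h < real n ^ q"
    and F: "finite F" "card F \<le> C" and C: "1 \<le> C"
    and forced: "\<And>w. set w \<subseteq> \<Lambda> \<Longrightarrow> p < length w \<Longrightarrow> pt w \<in> square (a, b) h \<Longrightarrow>
      snd ` set (drop p w) \<subseteq> F"
  shows "finite (forward_orbit m n \<Lambda> (of_int u, of_int v) \<inter> square (a, b) h)"
    and "card (forward_orbit m n \<Lambda> (of_int u, of_int v) \<inter> square (a, b) h)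
      \<le> (13 + 4 * q) * (card \<Lambda> ^ p * C ^ (q - p))"
proof -
  let ?O = "forward_orbit m n \<Lambda> (of_int u, of_int v) \<inter> square (a, b) h"
  let ?N = "card \<Lambda>"
  define U where "U = {x::int. (a + h) / real m ^ p - 2 \<le> real_of_int x \<and>
    real_of_int x \<le> (a + h) / real m ^ p}"
  define V where "V = {y::int. (b + h) / real n ^ q - 2 \<le> real_of_int y \<and>
    real_of_int y \<le> (b + h) / real n ^ q}"
  have U: "finite U" "card U \<le> 3" and V: "finite V" "card V \<le> 3"
    unfolding U_def V_def by (rule card_int_interval_le)+
  \<comment> \<open>Decoding: \<open>w\<close> is the prefix, \<open>s\<close> the further second
    digits, and \<open>x\<close>, \<open>y\<close> are the values of the remaining tails in the two
    coordinates.\<close>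
  define \<Phi> :: "nat \<Rightarrow> (nat \<times> nat) list \<times> nat list \<times> int \<times> int \<Rightarrow> real \<times> real" where
    "\<Phi> k = (\<lambda>(w, s, x, y). (of_int (expand m (map fst w) x), of_int (expand n (map snd w @ s) y)))"
    for k
  \<comment> \<open>The leading digits contribute between \<open>0\<close> and \<open>d ^ k\<close>,
    and the window adds less than another \<open>d ^ k\<close>. Hence the tail value ranges over an
    interval of length \<open>2\<close>.\<close>
  have mem: "x \<in> {x::int. (c + h) / real d ^ k - 2 \<le> real_of_int x \<and>
      real_of_int x \<le> (c + h) / real d ^ k}"
    if "set ds \<subseteq> {..<d}" "length ds = k" "2 * h < real d ^ k" "0 < d"
      "c - h \<le> of_int (expand d ds x)" "of_int (expand d ds x) \<le> c + h"
    for c d k ds x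
  proof -
    have "0 \<le> digit_value d ds" "digit_value d ds < int d ^ k"
      using digit_value_nonneg digit_value_less[OF that(1)] that(2) by auto
    then have *: "0 \<le> real_of_int (digit_value d ds)"
      "real_of_int (digit_value d ds) < real d ^ k"
      by (auto simp: of_int_less_iff[symmetric, where 'a = real] simp del: of_int_less_iff)
    have ex: "real_of_int (expand d ds x) = real_of_int (digit_value d ds) + real d ^ k * real_of_int x"
      by (simp add: expand_def that(2))
    have "real d ^ k * real_of_int x \<le> c + h"
      using that(6) * ex by linarith
    moreover have "c + h \<le> real d ^ k * (real_of_int x + 2)"
      using that(3,5) * ex by (simp add: algebra_simps)
    ultimately show ?thesis
      using \<open>0 < d\<close> by (simp add: field_simps)
  qed
  define X where "X = (\<Union>k\<le>p. pt ` lists_of \<Lambda> k)"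
  \<comment> \<open>For lengths up to \<open>q\<close> all second digits are recorded, so the second
    tail value is the starting value \<open>v\<close> itself; in \<open>Z\<close> it ranges over
    \<open>V\<close>.\<close>
  define Y where "Y = (\<Union>k\<in>{p..q}. \<Phi> k ` (lists_of \<Lambda> p \<times> lists_of F (k - p) \<times> U \<times> {v}))"
  define Z where "Z = \<Phi> q ` (lists_of \<Lambda> p \<times> lists_of F (q - p) \<times> U \<times> V)"
  note fin = finite_lists_of[OF finite_Lambda] finite_lists_of[OF F(1)] U(1) V(1)
  have sub: "?O \<subseteq> X \<union> Y \<union> Z"
  proof
    fix P assume P: "P \<in> ?O"
    then obtain w where w: "set w \<subseteq> \<Lambda>" "P = pt w"
      unfolding forward_orbit_eq pt_def by blast
    let ?k = "length w"
    show "P \<in> X \<union> Y \<union> Z"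
    proof (cases "?k \<le> p")
      case True
      then show ?thesis using w by (auto simp: X_def lists_of_def)
    next
      case False
      define w1 w2 where "w1 = take p w" and "w2 = drop p w"
      have sq: "pt w \<in> square (a, b) h" using P w(2) by simp
      have ww: "w = w1 @ w2" and w1: "length w1 = p" "set w1 \<subseteq> \<Lambda>"
        using False w(1) by (auto simp: w1_def w2_def dest: in_set_takeD)
      have w2: "snd ` set w2 \<subseteq> F" "set w2 \<subseteq> \<Lambda>" "length w2 = ?k - p"
        using forced[OF w(1) _ sq] False w(1) by (auto simp: w2_def dest: in_set_dropD)
      define x where "x = expand m (map fst w2) u"
      have pt: "pt w = (of_int (expand m (map fst w1) x),
          of_int (expand n (map snd w1) (expand n (map snd w2) v)))"
        unfolding pt_def word_map_of_int x_def by (simp add: ww expand_append)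
      have x: "x \<in> U"
        unfolding U_def
        using mem[of "map fst w1" m p a x] fst_digits[OF w1(2)] w1(1) p m_ge_2 sq
        by (simp add: pt square_iff del: set_map)
      show ?thesis
      proof (cases "?k \<le> q")
        case True
        have "P = \<Phi> ?k (w1, map snd w2, x, v)"
          by (simp add: w(2) pt \<Phi>_def expand_append)
        moreover have "(w1, map snd w2, x, v) \<in> lists_of \<Lambda> p \<times> lists_of F (?k - p) \<times> U \<times> {v}"
          using w1 w2 x by (simp add: lists_of_def)
        ultimately have "P \<in> Y"
          unfolding Y_def using True False by fastforce
        then show ?thesis by blast
      next
        case k: False
        define w3 w4 where "w3 = take (q - p) w2" and "w4 = drop (q - p) w2"
        have w34: "w2 = w3 @ w4" "length w3 = q - p" "set w3 \<subseteq> \<Lambda>" "snd ` set w3 \<subseteq> F"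
          using w2 k False pq by (auto simp: w3_def w4_def dest: in_set_takeD)
        define y where "y = expand n (map snd w4) v"
        have pt': "pt w = (of_int (expand m (map fst w1) x), of_int (expand n (map snd (w1 @ w3)) y))"
          by (simp add: pt w34(1) y_def expand_append)
        have y: "y \<in> V"
          unfolding V_def
          using mem[of "map snd (w1 @ w3)" n q b y] snd_digits[of "w1 @ w3"] w1 w34 q n_ge_2 pq sq
          by (simp add: pt' square_iff del: set_map map_append)
        have "P = \<Phi> q (w1, map snd w3, x, y)"
          by (simp add: w(2) pt' \<Phi>_def)
        moreover have "(w1, map snd w3, x, y) \<in> lists_of \<Lambda> p \<times> lists_of F (q - p) \<times> U \<times> V"
          using w1 w34 x y by (simp add: lists_of_def)
        ultimately have "P \<in> Z"
          unfolding Z_def by blast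
        then show ?thesis by blast
      qed
    qed
  qed
  have finXYZ: "finite (X \<union> Y \<union> Z)"
    unfolding X_def Y_def Z_def using fin by auto
  show "finite ?O"
    by (rule finite_subset[OF sub finXYZ])
  let ?M = "?N ^ p * C ^ (q - p)"
  have N: "1 \<le> ?N" by (rule card_Lambda_ge_1)
  have M: "?N ^ p * card F ^ (k - p) \<le> ?M" if "k \<le> q" for k
  proof -
    have "card F ^ (k - p) \<le> C ^ (k - p)" by (rule power_mono) (use F in auto)
    also have "\<dots> \<le> C ^ (q - p)" using C that by (intro power_increasing) auto
    finally show ?thesis by simp
  qed
  have "card X \<le> (\<Sum>k\<le>p. card (pt ` lists_of \<Lambda> k))"
    unfolding X_def by (rule card_UN_le) simp
  also have "\<dots> \<le> (\<Sum>k\<le>p. ?M)"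
  proof (rule sum_mono)
    fix k assume "k \<in> {..p}"
    then have "?N ^ k \<le> ?N ^ p * 1" using N by (auto intro: power_increasing)
    also have "\<dots> \<le> ?M" using C by (intro mult_left_mono) auto
    finally show "card (pt ` lists_of \<Lambda> k) \<le> ?M"
      by (simp add: pt_def card_word_map_image)
  qed
  also have "\<dots> \<le> (q + 1) * ?M"
    using pq by simp
  finally have cX: "card X \<le> (q + 1) * ?M" .
  have cY': "card (\<Phi> k ` (lists_of \<Lambda> p \<times> lists_of F (k - p) \<times> U \<times> {v})) \<le> 3 * ?M" if "k \<le> q" for k
  proof -
    have "card (\<Phi> k ` (lists_of \<Lambda> p \<times> lists_of F (k - p) \<times> U \<times> {v}))
      \<le> card (lists_of \<Lambda> p \<times> lists_of F (k - p) \<times> U \<times> {v})"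
      using fin by (intro card_image_le) auto
    also have "\<dots> = card U * (?N ^ p * card F ^ (k - p))"
      by (simp add: card_cartesian_product card_lists_of finite_Lambda F)
    also have "\<dots> \<le> 3 * ?M"
      by (rule mult_mono[OF U(2) M[OF that]]) auto
    finally show ?thesis .
  qed
  have "card Y \<le> (\<Sum>k\<in>{p..q}. card (\<Phi> k ` (lists_of \<Lambda> p \<times> lists_of F (k - p) \<times> U \<times> {v})))"
    unfolding Y_def by (rule card_UN_le) simp
  also have "\<dots> \<le> (\<Sum>k\<in>{p..q}. 3 * ?M)"
    using cY' by (intro sum_mono) auto
  also have "\<dots> \<le> (q + 1) * (3 * ?M)"
    unfolding sum_constant by (intro mult_right_mono) auto
  finally have cY: "card Y \<le> (q + 1) * (3 * ?M)" .
  have "card Z \<le> card (lists_of \<Lambda> p \<times> lists_of F (q - p) \<times> U \<times> V)"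
    unfolding Z_def using fin by (intro card_image_le) auto
  also have "\<dots> = card U * card V * (?N ^ p * card F ^ (q - p))"
    by (simp add: card_cartesian_product card_lists_of finite_Lambda F)
  also have "\<dots> \<le> (3 * 3) * ?M"
    by (rule mult_mono[OF mult_mono[OF U(2) V(2)] M[OF order_refl]]) auto
  finally have cZ: "card Z \<le> 9 * ?M" by simp
  have "card ?O \<le> card (X \<union> Y \<union> Z)"
    by (rule card_mono[OF finXYZ sub])
  also have "\<dots> \<le> card X + card Y + card Z"
    by (meson card_Un_le add_mono order_refl order_trans)
  also have "\<dots> \<le> (q + 1) * ?M + (q + 1) * (3 * ?M) + 9 * ?M"
    using cX cY cZ by linarith
  also have "\<dots> = (13 + 4 * q) * ?M"
    by (simp add: algebra_simps)
  finally show "card ?O \<le> (13 + 4 * q) * ?M" .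
qed

text \<open>The exponents are one above \<open>nat_log\<close>, so that both powers exceed the side
  \<open>2 * h\<close> of the window; this turns \<open>13 + 4 * q\<close> into
  \<open>17 + 4 * nat_log n (2 * h)\<close>.\<close>

lemma orbit_window_count_le:
  fixes u v :: int and F :: "nat set" and a b h :: real
  assumes h: "1 \<le> 2 * h" and F: "finite F" "card F \<le> C" and C: "1 \<le> C"
    and forced: "\<And>w. set w \<subseteq> \<Lambda> \<Longrightarrow> Suc (nat_log m (2 * h)) < length w \<Longrightarrow>
      word_map m n w (of_int u, of_int v) \<in> square (a, b) h \<Longrightarrow>
      snd ` set (drop (Suc (nat_log m (2 * h))) w) \<subseteq> F"
  shows "finite (forward_orbit m n \<Lambda> (of_int u, of_int v) \<inter> square (a, b) h)"
    and "real (card (forward_orbit m n \<Lambda> (of_int u, of_int v) \<inter> square (a, b) h))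
      \<le> 17 * real (card \<Lambda>) * (1 + real (nat_log n (2 * h))) * square_count m n (card \<Lambda>) C (2 * h)"
proof -
  let ?O = "forward_orbit m n \<Lambda> (of_int u, of_int v) \<inter> square (a, b) h"
  let ?p = "Suc (nat_log m (2 * h))" and ?q = "Suc (nat_log n (2 * h))"
  have pq: "?p \<le> ?q"
    using nat_log_antimono_base[OF n_ge_2 n_le_m h] by simp
  note bound = orbit_window_card_le[OF pq less_power_Suc_nat_log[OF m_ge_2 h]
      less_power_Suc_nat_log[OF n_ge_2 h] F C forced]
  show "finite ?O" by (rule bound(1))
  have "real (card ?O) \<le> real ((13 + 4 * ?q) * (card \<Lambda> ^ ?p * C ^ (?q - ?p)))"
    using bound(2) by (rule of_nat_mono)
  also have "\<dots> = (17 + 4 * real (nat_log n (2 * h))) * (real (card \<Lambda>) * square_count m n (card \<Lambda>) C (2 * h))"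
    unfolding square_count_Suc[symmetric] by simp
  also have "\<dots> \<le> (17 * (1 + real (nat_log n (2 * h)))) *
      (real (card \<Lambda>) * square_count m n (card \<Lambda>) C (2 * h))"
    using square_count_pos[OF card_Lambda_ge_1 C, of m n "2 * h"]
    by (intro mult_right_mono) auto
  finally show "real (card ?O) \<le> 17 * real (card \<Lambda>) * (1 + real (nat_log n (2 * h)))
      * square_count m n (card \<Lambda>) C (2 * h)"
    by (simp add: ac_simps)
qed

text \<open>Taking every nonempty row as an allowed second digit makes the constraint automatic, so
  the bound is uniform in the centre \<open>w\<close>, as the Beurling dimension requires.\<close>

lemma orbit_count_le_all_rows:
  fixes u v :: int
  assumes "1 \<le> 2 * h"
  shows "real (card (forward_orbit m n \<Lambda> (of_int u, of_int v) \<inter> square w h))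
      \<le> 17 * real (card \<Lambda>) * (1 + real (nat_log n (2 * h)))
        * square_count m n (card \<Lambda>) (card (snd ` \<Lambda>)) (2 * h)"
proof (cases w)
  case (Pair a b)
  have "1 \<le> card (snd ` \<Lambda>)"
    by (rule card_rows_ge_1)
  then show ?thesis
    unfolding Pair using assms finite_Lambda
    by (intro orbit_window_count_le(2)[where F = "snd ` \<Lambda>"]) (auto dest: in_set_dropD)
qed

text \<open>Beyond level \<open>log\<^sub>m h\<close> a word can only keep the orbit in \<open>[-h, h]\<^sup>2\<close> if \<open>u\<close> is \<open>0\<close> or
  \<open>-1\<close> and all its further first digits equal \<open>u mod m\<close>; these are the second digits it may use.\<close>

definition column :: "int \<Rightarrow> nat set" where
  "column u = {j. (u = 0 \<or> u = -1) \<and> (nat (u mod int m), j) \<in> \<Lambda>}"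

text \<open>For an empty column the words of length about log h / log m still remain; this is the
  value \<open>C = 1\<close>.\<close>

definition column_size :: "int \<Rightarrow> nat" where
  "column_size u = max 1 (card (column u))"

lemma column_subset: "column u \<subseteq> snd ` \<Lambda>"
  by (force simp: column_def)

lemma finite_column: "finite (column u)"
  using column_subset finite_Lambda by (rule finite_subset[OF _ finite_imageI])

text \<open>In a window about the origin the tail of the first coordinate after \<open>?p\<close>
  digits can only be \<open>0\<close> or \<open>-1\<close>. By \<open>expand_in_0_minus_1\<close>
  this tail equals \<open>u\<close> and forces its first digits, so the second digits come from
  \<open>column u\<close>.\<close>

lemma orbit_centred_bound:
  fixes u v :: int
  assumes h: "1 \<le> 2 * h"
  shows "finite (forward_orbit m n \<Lambda> (of_int u, of_int v) \<inter> square 0 h)"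
    and "real (card (forward_orbit m n \<Lambda> (of_int u, of_int v) \<inter> square 0 h))
      \<le> 17 * real (card \<Lambda>) * (1 + real (nat_log n (2 * h)))
        * square_count m n (card \<Lambda>) (column_size u) (2 * h)"
proof -
  let ?p = "Suc (nat_log m (2 * h))"
  have forced: "snd ` set (drop ?p w) \<subseteq> column u"
    if w: "set w \<subseteq> \<Lambda>" "?p < length w"
      and sq: "word_map m n w (of_int u, of_int v) \<in> square (0, 0) h" for w
  proof -
    define w1 w2 where "w1 = take ?p w" and "w2 = drop ?p w"
    have ww: "w = w1 @ w2" "length w1 = ?p" "set w1 \<subseteq> \<Lambda>" "set w2 \<subseteq> \<Lambda>" "w2 \<noteq> []"
      using w by (auto simp: w1_def w2_def dest: in_set_takeD in_set_dropD)
    define x where "x = expand m (map fst w2) u"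
    have d: "0 \<le> digit_value m (map fst w1)" "digit_value m (map fst w1) < int m ^ ?p"
      using digit_value_nonneg digit_value_less[OF fst_digits[OF ww(3)]] ww(2) by auto
    have X: "expand m (map fst w) u = digit_value m (map fst w1) + int m ^ ?p * x"
      by (simp only: ww(1) map_append expand_append x_def) (simp add: expand_def ww(2))
    have hm: "h < real m ^ ?p"
      using less_power_Suc_nat_log[OF m_ge_2 h] h by linarith
    have "\<bar>real_of_int (expand m (map fst w) u)\<bar> \<le> h"
      using sq by (simp add: word_map_of_int square_iff abs_le_iff)
    then have "\<bar>real_of_int (expand m (map fst w) u)\<bar> < real m ^ ?p"
      using hm by linarith
    then have "real_of_int \<bar>expand m (map fst w) u\<bar> < real_of_int (int m ^ ?p)"
      by simp
    then have absX: "\<bar>expand m (map fst w) u\<bar> < int m ^ ?p"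
      by (simp only: of_int_less_iff)
    have pos: "0 < int m ^ ?p" using m_ge_2 by simp
    \<comment> \<open>The prefix value lies in \<open>[0, m ^ ?p)\<close> and the whole expansion
      strictly between \<open>- m ^ ?p\<close> and \<open>m ^ ?p\<close>.\<close>
    have "int m ^ ?p * x < int m ^ ?p * 1" "int m ^ ?p * (-2) < int m ^ ?p * x"
      using absX d unfolding X by linarith+
    then have "x < 1" "-2 < x"
      using mult_less_cancel_left_pos[OF pos] by blast+
    then have "x = 0 \<or> x = -1" by linarith
    from expand_in_0_minus_1[OF _ this fst_digits[OF ww(4)], of u]
    have ux: "u = x" and col: "set (map fst w2) \<subseteq> {nat (u mod int m)}"
      by (auto simp: x_def)
    show ?thesis
      unfolding w2_def[symmetric] column_def
      using \<open>x = 0 \<or> x = -1\<close> ux col ww(4) by fastforce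
  qed
  have 0: "(0 :: real \<times> real) = (0, 0)" by (simp add: zero_prod_def)
  have C: "card (column u) \<le> column_size u" "1 \<le> column_size u"
    by (auto simp: column_size_def)
  show "finite (forward_orbit m n \<Lambda> (of_int u, of_int v) \<inter> square 0 h)"
    unfolding 0 by (rule orbit_window_count_le(1)[OF h finite_column C forced])
  show "real (card (forward_orbit m n \<Lambda> (of_int u, of_int v) \<inter> square 0 h))
      \<le> 17 * real (card \<Lambda>) * (1 + real (nat_log n (2 * h)))
        * square_count m n (card \<Lambda>) (column_size u) (2 * h)"
    unfolding 0 by (rule orbit_window_count_le(2)[OF h finite_column C forced])
qed

text \<open>For a nonempty column, take \<open>p\<close> arbitrary letters followed by
  \<open>q - p\<close> letters whose first digit is the forced one: the first coordinate grows like
  \<open>m ^ p\<close>, the second like \<open>n ^ q\<close>. Otherwise words of length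
  \<open>p\<close> suffice. The factor \<open>c\<close> absorbs the size of the starting
  point.\<close>

lemma orbit_count_ge:
  fixes u v :: int
  defines "c \<equiv> real_of_int (\<bar>u\<bar> + \<bar>v\<bar> + 1)"
  assumes h: "c * real m \<le> h"
  shows "square_count m n (card \<Lambda>) (column_size u) (1 / c * h)
    \<le> real (card (forward_orbit m n \<Lambda> (of_int u, of_int v) \<inter> square 0 h))"
proof -
  let ?O = "forward_orbit m n \<Lambda> (of_int u, of_int v) \<inter> square 0 h"
  let ?pt = "\<lambda>w. word_map m n w (of_int u, of_int v)"
  define p q where "p = nat_log m (1 / c * h)" and "q = nat_log n (1 / c * h)"
  have c: "1 \<le> c" by (simp add: c_def)
  have hm: "real m \<le> 1 / c * h" using h c by (simp add: field_simps)
  have h1: "1 \<le> 1 / c * h" using hm m_ge_2 by linarith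
  have mp: "real m ^ p \<le> 1 / c * h" and nq: "real n ^ q \<le> 1 / c * h"
    unfolding p_def q_def using power_nat_log_le h1 m_ge_2 n_ge_2 by blast+
  have pq: "p \<le> q"
    unfolding p_def q_def by (rule nat_log_antimono_base[OF n_ge_2 n_le_m h1])
  have p1: "1 \<le> p"
    unfolding p_def using le_nat_log_iff[OF m_ge_2 h1, of 1] hm by simp
  have fin: "finite ?O"
  proof (rule orbit_centred_bound(1))
    have "1 * 2 \<le> c * real m" using c m_ge_2 by (intro mult_mono) auto
    with h show "1 \<le> 2 * h" by linarith
  qed
  have le_h: "\<bar>real_of_int (expand b ds z)\<bar> \<le> h"
    if ds: "set ds \<subseteq> {..<b}" "real b ^ length ds \<le> 1 / c * h" and z: "z = u \<or> z = v" for b ds z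
  proof -
    have "real_of_int \<bar>expand b ds z\<bar> \<le> real_of_int (int b ^ length ds * (\<bar>z\<bar> + 1))"
      using abs_expand_le[OF ds(1)] by (simp only: of_int_le_iff)
    also have "\<dots> = real b ^ length ds * (real_of_int \<bar>z\<bar> + 1)"
      by simp
    also have "\<dots> \<le> 1 / c * h * c"
      using ds(2) z h1 by (intro mult_mono) (auto simp: c_def)
    finally show ?thesis using c by simp
  qed
  have inO: "?pt w \<in> ?O" if "set w \<subseteq> \<Lambda>" "w \<noteq> []"
    "\<bar>real_of_int (expand m (map fst w) u)\<bar> \<le> h" "\<bar>real_of_int (expand n (map snd w) v)\<bar> \<le> h" for w
    using that unfolding forward_orbit_eq zero_prod_def
    by (auto simp: word_map_of_int square_iff abs_le_iff)
  show ?thesis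
  proof (cases "column u = {}")
    case True
    have "?pt w \<in> ?O" if "w \<in> lists_of \<Lambda> p" for w
    proof (rule inO)
      have w: "set w \<subseteq> \<Lambda>" "length w = p" using that by (auto simp: lists_of_def)
      then show "set w \<subseteq> \<Lambda>" "w \<noteq> []" using p1 by auto
      show "\<bar>real_of_int (expand m (map fst w) u)\<bar> \<le> h"
        using le_h[OF fst_digits[OF w(1)], of u] w(2) mp by simp
      have "real n ^ p \<le> real n ^ q" using pq n_ge_2 by (intro power_increasing) auto
      then show "\<bar>real_of_int (expand n (map snd w) v)\<bar> \<le> h"
        using le_h[OF snd_digits[OF w(1)], of v] w(2) nq by simp
    qed
    then have "card (?pt ` lists_of \<Lambda> p) \<le> card ?O"
      by (intro card_mono[OF fin]) auto
    then have "real (card \<Lambda> ^ p) \<le> real (card ?O)"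
      unfolding card_word_map_image by (rule of_nat_mono)
    then show ?thesis
      using True by (simp add: square_count_def column_size_def p_def)
  next
    case False
    define e where "e = nat (u mod int m)"
    have u: "u = 0 \<or> u = -1" and col: "column u = {j. (e, j) \<in> \<Lambda>}"
      using False by (auto simp: column_def e_def)
    define g :: "(nat \<times> nat) list \<times> nat list \<Rightarrow> (nat \<times> nat) list"
      where "g = (\<lambda>(w, s). w @ map (Pair e) s)"
    let ?D = "lists_of \<Lambda> p \<times> lists_of (column u) (q - p)"
    have g: "set (g t) \<subseteq> \<Lambda> \<and> length (g t) = q" if "t \<in> ?D" for t
      using that pq by (auto simp: g_def lists_of_def col)
    have "?pt (g t) \<in> ?O" if t: "t \<in> ?D" for t
    proof (rule inO)
      show "set (g t) \<subseteq> \<Lambda>" using g[OF t] by blast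
      show "g t \<noteq> []" using g[OF t] p1 pq by auto
      obtain w s where ws: "t = (w, s)" "set w \<subseteq> \<Lambda>" "length w = p" "length s = q - p"
        using t by (auto simp: lists_of_def)
      \<comment> \<open>The appended letters fix \<open>u\<close>, so only the \<open>p\<close>
        letters of \<open>w\<close> act on the first coordinate.\<close>
      have "expand m (map fst (g t)) u = expand m (map fst w) (expand m (replicate (q - p) e) u)"
        by (simp add: g_def ws expand_append comp_def map_replicate_const)
      also have "expand m (replicate (q - p) e) u = u"
        unfolding e_def using expand_replicate m_ge_2 u by simp
      finally show "\<bar>real_of_int (expand m (map fst (g t)) u)\<bar> \<le> h"
        using le_h[OF fst_digits[OF ws(2)], of u] ws(3) mp by simp
      show "\<bar>real_of_int (expand n (map snd (g t)) v)\<bar> \<le> h"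
        using le_h[OF snd_digits, of "g t" v] g[OF t] nq by simp
    qed
    moreover have "inj_on (\<lambda>t. ?pt (g t)) ?D"
    proof (rule inj_onI)
      fix t t' assume t: "t \<in> ?D" "t' \<in> ?D" "?pt (g t) = ?pt (g t')"
      then have "g t = g t'"
        using g by (intro word_map_inj) (auto simp: lists_of_def)
      moreover obtain w s w' s' where ts: "t = (w, s)" "t' = (w', s')" by fastforce
      ultimately have "w = w' \<and> map (Pair e) s = map (Pair e) s'"
        using t(1,2) by (simp add: g_def lists_of_def)
      then show "t = t'"
        unfolding ts by (metis inj_map_eq_map Pair_inject injI)
    qed
    ultimately have "card ?D \<le> card ?O"
      using fin by (intro card_inj_on_le) auto
    then have "card \<Lambda> ^ p * card (column u) ^ (q - p) \<le> card ?O"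
      by (simp add: card_cartesian_product card_lists_of finite_Lambda finite_column)
    then have "real (card \<Lambda> ^ p * card (column u) ^ (q - p)) \<le> real (card ?O)"
      by (rule of_nat_mono)
    moreover have "column_size u = card (column u)"
      using False finite_column by (simp add: column_size_def max_def not_le Suc_le_eq card_gt_0_iff)
    ultimately show ?thesis
      by (simp add: square_count_def p_def q_def)
  qed
qed

section \<open>Minkowski and Beurling dimensions of the orbit\<close>

lemma minkowski_quotient_tendsto:
  fixes u v :: int
  shows "(minkowski_quotient (forward_orbit m n \<Lambda> (of_int u, of_int v))
    \<longlongrightarrow> carpet_dim m n (card \<Lambda>) (column_size u)) at_top"
  unfolding minkowski_quotient_def
proof (rule ln_count_tendsto[where a = 1 and A = "17 * real (card \<Lambda>)" and d = 2
      and c = "1 / real_of_int (\<bar>u\<bar> + \<bar>v\<bar> + 1)"])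
  let ?O = "\<lambda>h. forward_orbit m n \<Lambda> (of_int u, of_int v) \<inter> square 0 h"
  let ?c = "real_of_int (\<bar>u\<bar> + \<bar>v\<bar> + 1)"
  show "\<forall>\<^sub>F h in at_top. 1 * square_count m n (card \<Lambda>) (column_size u) (1 / ?c * h)
      \<le> real (card (?O h))"
    using eventually_ge_at_top[of "?c * real m"]
  proof eventually_elim
    case (elim h)
    then show ?case using orbit_count_ge[of u v h] by simp
  qed
  show "\<forall>\<^sub>F h in at_top. real (card (?O h))
      \<le> 17 * real (card \<Lambda>) * (1 + real (nat_log n (2 * h)))
        * square_count m n (card \<Lambda>) (column_size u) (2 * h)"
    using eventually_ge_at_top[of 1]
  proof eventually_elim
    case (elim h)
    then show ?case using orbit_centred_bound(2)[of h u v] by simp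
  qed
qed (use n_ge_2 n_le_m card_Lambda_ge_1 in \<open>auto simp: column_size_def\<close>)

text \<open>From below, the supremum over centres includes the origin; from above, the bound for all
  rows does not depend on the centre.\<close>

lemma beurling_dim_bounds:
  fixes u v :: int
  defines "A \<equiv> forward_orbit m n \<Lambda> (of_int u, of_int v)"
  shows "ereal (carpet_dim m n (card \<Lambda>) (column_size u)) \<le> beurling_dim A"
    and "beurling_dim A \<le> ereal (carpet_dim m n (card \<Lambda>) (card (snd ` \<Lambda>)))"
proof -
  let ?q = "\<lambda>w h. ereal (ln (real (card (A \<inter> square w h))) / ln h)"
  have "ereal (carpet_dim m n (card \<Lambda>) (column_size u)) = Limsup at_top (?q 0)"
    using minkowski_quotient_tendsto[of u v]
    by (intro lim_imp_Limsup[symmetric]) (auto simp: minkowski_quotient_def[abs_def] A_def)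
  also have "\<dots> \<le> beurling_dim A"
    unfolding beurling_dim_def by (intro Limsup_mono always_eventually allI SUP_upper UNIV_I)
  finally show "ereal (carpet_dim m n (card \<Lambda>) (column_size u)) \<le> beurling_dim A" .
  let ?C = "card (snd ` \<Lambda>)"
  let ?B = "\<lambda>h. 17 * real (card \<Lambda>) * (1 + real (nat_log n (2 * h))) * square_count m n (card \<Lambda>) ?C (2 * h)"
  have C: "1 \<le> ?C"
    by (rule card_rows_ge_1)
  have "\<forall>\<^sub>F h in at_top. (SUP w. ?q w h) \<le> ereal (ln (?B h) / ln h)"
    using eventually_gt_at_top[of 1]
  proof eventually_elim
    case (elim h)
    \<comment> \<open>Squares that miss \<open>A\<close> contribute \<open>ln 0 = 0\<close>, so the
      majorant must have a nonnegative logarithm.\<close>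
    have "1 \<le> real (card \<Lambda>) * (1 + real (nat_log n (2 * h)))"
      using card_Lambda_ge_1 by (intro mult_ge1_I) auto
    moreover have "1 \<le> square_count m n (card \<Lambda>) ?C (2 * h)"
      unfolding square_count_def using card_Lambda_ge_1 C by (intro mult_ge1_I one_le_power) auto
    ultimately have "1 * 1 \<le> (17 * (real (card \<Lambda>) * (1 + real (nat_log n (2 * h))))) *
        square_count m n (card \<Lambda>) ?C (2 * h)"
      by (intro mult_mono) auto
    then have B: "1 \<le> ?B h" by (simp add: mult.assoc)
    have "ln (real (card (A \<inter> square w h))) / ln h \<le> ln (?B h) / ln h" for w
    proof (intro divide_right_mono)
      have le: "real (card (A \<inter> square w h)) \<le> ?B h"
        unfolding A_def using elim by (intro orbit_count_le_all_rows) auto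
      show "ln (real (card (A \<inter> square w h))) \<le> ln (?B h)"
      proof (cases "card (A \<inter> square w h) = 0")
        case True
        then show ?thesis using B by (simp del: card_eq_0_iff)
      next
        case False
        then show ?thesis using le by (intro ln_mono) auto
      qed
    qed (use elim in auto)
    then show ?case by (intro SUP_least) simp
  qed
  then have "beurling_dim A \<le> Limsup at_top (\<lambda>h. ereal (ln (?B h) / ln h))"
    unfolding beurling_dim_def by (rule Limsup_mono)
  also have "\<dots> = ereal (carpet_dim m n (card \<Lambda>) ?C)"
    using ln_upper_bound_tendsto[of n m "card \<Lambda>" ?C 2 "17 * real (card \<Lambda>)"]
      n_ge_2 n_le_m card_Lambda_ge_1 C
    by (intro lim_imp_Limsup) auto
  finally show "beurling_dim A \<le> ereal (carpet_dim m n (card \<Lambda>) ?C)" .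
qed

end


context digit_system
begin

section \<open>Box counting for the dual attractor\<close>

lemma S_inv_eq_iff: "S_inv m n d P = Q \<longleftrightarrow> P = S m n d Q"
  using n_ge_2 m_ge_2 by (cases d; cases P; cases Q) (auto simp: S_inv_def S_def)

lemma dist_S_inv_le: "dist (S_inv m n d P) (S_inv m n d Q) \<le> 1 / real n * dist P Q"
proof -
  obtain i j x y x' y' where [simp]: "d = (i, j)" "P = (x, y)" "Q = (x', y')"
    by (cases d; cases P; cases Q) auto
  have le: "1 / real m \<le> 1 / real n"
    using n_ge_2 n_le_m by (simp add: field_simps)
  have "norm ((x - x') / real m) \<le> norm ((x - x') / real n)"
    using mult_right_mono[OF le, of "\<bar>x - x'\<bar>"] by simp
  then have "norm ((x - x') / real m, (y - y') / real n) \<le> norm ((x - x') / real n, (y - y') / real n)"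
    unfolding norm_Pair by (intro real_sqrt_le_mono add_right_mono power_mono) auto
  also have "\<dots> = norm ((1 / real n) *\<^sub>R (x - x', y - y'))"
    by simp
  also have "\<dots> = 1 / real n * dist P Q"
    by (simp only: norm_scaleR) (simp add: dist_norm)
  finally show ?thesis
    by (simp add: S_inv_def dist_norm diff_divide_distrib)
qed

text \<open>The square \<open>[-1, 0]\<close> x \<open>[-1, 0]\<close> is mapped into itself because
  digits are at most \<open>m - 1\<close> and \<open>n - 1\<close>, so an invariant set exists
  inside it. Contraction by \<open>1 / n\<close> makes it unique, which gives the definite
  description in \<open>attractor\<close> its meaning.\<close>

lemma shows K_dual_nonempty: "K_dual m n \<Lambda> \<noteq> {}"
    and K_dual_subset: "K_dual m n \<Lambda> \<subseteq> {-1..0} \<times> {-1..0}"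
    and K_dual_eq: "K_dual m n \<Lambda> = (\<Union>d\<in>\<Lambda>. S_inv m n d ` K_dual m n \<Lambda>)"
proof -
  let ?F = "S_inv m n ` \<Lambda>"
  let ?P = "\<lambda>K. compact K \<and> K \<noteq> {} \<and> K = (\<Union>f\<in>?F. f ` K)"
  have "\<exists>K. compact K \<and> K \<noteq> {} \<and> K \<subseteq> {-1..0} \<times> {-1..0} \<and> K = (\<Union>f\<in>?F. f ` K)"
  proof (rule invariant_compact_exists)
    show "finite ?F" "?F \<noteq> {}" using finite_Lambda nonempty by auto
    show "compact ({-1..0} \<times> {-1..0} :: (real \<times> real) set)" by (intro compact_Times) auto
    fix f assume "f \<in> ?F"
    then obtain d where d: "d \<in> \<Lambda>" "f = S_inv m n d" by blast
    have "1-lipschitz_on UNIV f"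
    proof (rule lipschitz_onI)
      fix P Q :: "real \<times> real"
      have "1 / real n * dist P Q \<le> 1 * dist P Q"
        using n_ge_2 by (intro mult_right_mono) auto
      then show "dist (f P) (f Q) \<le> 1 * dist P Q"
        unfolding d(2) using dist_S_inv_le[of d P Q] by linarith
    qed simp
    then show "continuous_on UNIV f" by (rule lipschitz_on_continuous_on)
    show "inj f" unfolding d(2) by (metis S_inv_eq_iff injI)
    have "fst d < m" "snd d < n" using d(1) digits by auto
    then show "f ` ({-1..0} \<times> {-1..0}) \<subseteq> {-1..0} \<times> {-1..0}"
      unfolding d(2) by (auto simp: S_inv_def field_simps split: prod.splits)
  qed simp
  then obtain K where K: "?P K" and sub: "K \<subseteq> {-1..0} \<times> {-1..0}" by blast
  have uniq: "K' \<subseteq> K''" if "?P K'" "?P K''" for K' K''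
  proof (rule invariant_compact_subset)
    show "0 \<le> 1 / real n" "1 / real n < 1" using n_ge_2 by auto
    show "dist (f x) (f y) \<le> 1 / real n * dist x y" if "f \<in> ?F" for f x y
      using that by (elim imageE) (simp only: dist_S_inv_le)
  qed (use that in \<open>blast+\<close>)
  have eq: "K_dual m n \<Lambda> = K"
    unfolding K_dual_def attractor_def
    by (rule the_equality) (use K uniq in blast)+
  show "K_dual m n \<Lambda> \<noteq> {}"
    "K_dual m n \<Lambda> \<subseteq> {-1..0} \<times> {-1..0}"
    "K_dual m n \<Lambda> = (\<Union>d\<in>\<Lambda>. S_inv m n d ` K_dual m n \<Lambda>)"
    unfolding eq using K sub by (blast, blast, simp only: image_image)
qed

text \<open>Invariance iterated \<open>k\<close> times, written with the expanding maps. Each step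
  puts a letter in front, so digits found later are less significant.\<close>

lemma K_dual_iff_word:
  "P \<in> K_dual m n \<Lambda> \<longleftrightarrow> (\<exists>w\<in>lists_of \<Lambda> k. word_map m n w P \<in> K_dual m n \<Lambda>)"
proof (induction k arbitrary: P)
  case 0
  then show ?case by (simp add: lists_of_def)
next
  case (Suc k)
  have step: "Q \<in> K_dual m n \<Lambda> \<longleftrightarrow> (\<exists>d\<in>\<Lambda>. S m n d Q \<in> K_dual m n \<Lambda>)" for Q
  proof -
    have "(Q \<in> (\<Union>d\<in>\<Lambda>. S_inv m n d ` K_dual m n \<Lambda>)) \<longleftrightarrow> (\<exists>d\<in>\<Lambda>. S m n d Q \<in> K_dual m n \<Lambda>)"
      by (simp add: image_iff eq_commute[of Q] S_inv_eq_iff)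
    then show ?thesis by (simp only: K_dual_eq[symmetric])
  qed
  have Suc_eq: "lists_of \<Lambda> (Suc k) = (\<lambda>(w, d). d # w) ` (lists_of \<Lambda> k \<times> \<Lambda>)"
    by (auto simp: lists_of_def length_Suc_conv image_iff)
  have "P \<in> K_dual m n \<Lambda> \<longleftrightarrow> (\<exists>w\<in>lists_of \<Lambda> k. word_map m n w P \<in> K_dual m n \<Lambda>)"
    by (rule Suc.IH)
  also have "\<dots> \<longleftrightarrow> (\<exists>w\<in>lists_of \<Lambda> k. \<exists>d\<in>\<Lambda>. S m n d (word_map m n w P) \<in> K_dual m n \<Lambda>)"
    by (intro bex_cong refl step)
  also have "\<dots> \<longleftrightarrow> (\<exists>w\<in>lists_of \<Lambda> (Suc k). word_map m n w P \<in> K_dual m n \<Lambda>)"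
    unfolding Suc_eq by simp
  finally show ?case .
qed

text \<open>The code \<open>(a, b)\<close> stands for the rectangle
  \<open>[-(a+1)/m\<^sup>p, -a/m\<^sup>p] \<times> [-(b+1)/n\<^sup>q, -b/n\<^sup>q]\<close>. Digit lists start with the least significant
  digit, so the free second digits \<open>s\<close> come first here, whereas for orbit points they come last.\<close>

definition rect_codes :: "nat \<Rightarrow> nat \<Rightarrow> (int \<times> int) set" where
  "rect_codes p q = (\<lambda>(w, s). (digit_value m (map fst w), digit_value n (s @ map snd w))) `
     (lists_of \<Lambda> p \<times> lists_of (snd ` \<Lambda>) (q - p))"

definition meets_rect :: "nat \<Rightarrow> nat \<Rightarrow> real \<times> real \<Rightarrow> int \<times> int \<Rightarrow> bool" where
  "meets_rect p q = (\<lambda>(x, y) (a, b).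
     real m ^ p * x + of_int a \<in> {-1..0} \<and> real n ^ q * y + of_int b \<in> {-1..0})"

lemma finite_rect_codes: "finite (rect_codes p q)"
  unfolding rect_codes_def
  using finite_Lambda by (intro finite_imageI finite_cartesian_product finite_lists_of) auto

lemma card_rect_codes: "card (rect_codes p q) = card \<Lambda> ^ p * card (snd ` \<Lambda>) ^ (q - p)"
proof -
  have "inj_on (\<lambda>(w, s). (digit_value m (map fst w), digit_value n (s @ map snd w)))
    (lists_of \<Lambda> p \<times> lists_of (snd ` \<Lambda>) (q - p))"
  proof (rule inj_onI, clarify)
    fix w s w' s'
    assume w: "w \<in> lists_of \<Lambda> p" "w' \<in> lists_of \<Lambda> p"
      and s: "s \<in> lists_of (snd ` \<Lambda>) (q - p)" "s' \<in> lists_of (snd ` \<Lambda>) (q - p)"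
      and eq: "digit_value m (map fst w) = digit_value m (map fst w')"
        "digit_value n (s @ map snd w) = digit_value n (s' @ map snd w')"
    have len: "length w = length w'" "length s = length s'" and sub: "set w \<subseteq> \<Lambda>" "set w' \<subseteq> \<Lambda>"
      "set s \<subseteq> snd ` \<Lambda>" "set s' \<subseteq> snd ` \<Lambda>"
      using w s by (auto simp: lists_of_def)
    have "snd ` \<Lambda> \<subseteq> {..<n}" using digits by auto
    then have "set (s @ map snd w) \<subseteq> {..<n}" "set (s' @ map snd w') \<subseteq> {..<n}"
      using snd_digits[OF sub(1)] snd_digits[OF sub(2)] sub(3,4) by auto
    then have "s @ map snd w = s' @ map snd w'"
      using len eq(2) by (intro digit_value_inj) auto
    then have "s = s'" "map snd w = map snd w'" using len by auto
    moreover have "map fst w = map fst w'"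
      using len eq(1) fst_digits[OF sub(1)] fst_digits[OF sub(2)] by (intro digit_value_inj) auto
    ultimately show "w = w' \<and> s = s'" by (metis zip_map_fst_snd)
  qed
  then show ?thesis
    unfolding rect_codes_def
    using finite_Lambda by (simp add: card_image card_cartesian_product card_lists_of)
qed

text \<open>The second coordinate is already at level \<open>q\<close>. In the first, the
  \<open>q - p\<close> least significant digits are discarded: their value is between
  \<open>0\<close> and \<open>m ^ (q - p) - 1\<close>, which keeps \<open>X\<close> in
  \<open>[-1, 0]\<close>.\<close>

lemma meets_rect_of_word:
  assumes "word_map m n (v @ w) P \<in> {-1..0} \<times> {-1..0}" "set v \<subseteq> \<Lambda>" "length w = p"
    "length v = q - p" "p \<le> q"
  shows "meets_rect p q P (digit_value m (map fst w), digit_value n (map snd v @ map snd w))"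
proof -
  obtain x y where P: "P = (x, y)" by (cases P)
  have len: "length (v @ w) = q" using assms by simp
  have "digit_value m (map fst v) < int m ^ (q - p)"
    using digit_value_less[OF fst_digits[OF assms(2)]] assms(4) by simp
  then have v: "real_of_int (digit_value m (map fst v)) \<le> real m ^ (q - p) - 1"
    by (simp add: int_less_real_le)
  have v0: "0 \<le> real_of_int (digit_value m (map fst v))"
    using digit_value_nonneg by simp
  define X where "X = real m ^ p * x + of_int (digit_value m (map fst w))"
  have "real m ^ q = real m ^ (q - p) * real m ^ p"
    using assms(5) by (simp flip: power_add)
  then have "real m ^ q * x + of_int (digit_value m (map fst (v @ w))) =
      real m ^ (q - p) * X + of_int (digit_value m (map fst v))"
    using assms(4) by (simp add: X_def horner_sum_append algebra_simps)
  then have "-1 \<le> real m ^ (q - p) * X + of_int (digit_value m (map fst v))"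
    "real m ^ (q - p) * X + of_int (digit_value m (map fst v)) \<le> 0"
    using assms(1) unfolding P word_map_apply len by auto
  then have "real m ^ (q - p) * (-1) \<le> real m ^ (q - p) * X" "real m ^ (q - p) * X \<le> real m ^ (q - p) * 0"
    using v v0 by linarith+
  moreover have "0 < real m ^ (q - p)" using m_ge_2 by simp
  ultimately have "-1 \<le> X" "X \<le> 0"
    using mult_le_cancel_left_pos by blast+
  then show ?thesis
    using assms(1) unfolding P word_map_apply len meets_rect_def X_def by auto
qed

lemma K_dual_point_meets_rect:
  assumes "P \<in> K_dual m n \<Lambda>" "p \<le> q"
  shows "\<exists>c\<in>rect_codes p q. meets_rect p q P c"
proof -
  obtain w where w: "w \<in> lists_of \<Lambda> q" "word_map m n w P \<in> K_dual m n \<Lambda>"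
    using K_dual_iff_word assms(1) by blast
  define w1 w2 where "w1 = take (q - p) w" and "w2 = drop (q - p) w"
  have ww: "w = w1 @ w2" "length w1 = q - p" "length w2 = p" "set w1 \<subseteq> \<Lambda>" "set w2 \<subseteq> \<Lambda>"
    using w(1) assms(2)
    by (auto simp: w1_def w2_def lists_of_def dest: in_set_takeD in_set_dropD)
  have "word_map m n (w1 @ w2) P \<in> {-1..0} \<times> {-1..0}"
    using w(2) K_dual_subset ww(1) by auto
  then have "meets_rect p q P (digit_value m (map fst w2), digit_value n (map snd w1 @ map snd w2))"
    using ww assms(2) by (intro meets_rect_of_word) auto
  moreover have "(w2, map snd w1) \<in> lists_of \<Lambda> p \<times> lists_of (snd ` \<Lambda>) (q - p)"
    using ww by (auto simp: lists_of_def)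
  then have "(digit_value m (map fst w2), digit_value n (map snd w1 @ map snd w2)) \<in> rect_codes p q"
    unfolding rect_codes_def by (rule rev_image_eqI) simp
  ultimately show ?thesis by blast
qed

text \<open>Each digit of \<open>s\<close> is the second digit of some letter; completing
  \<open>s\<close> to a word \<open>v\<close> gives a word \<open>v @ w\<close> of length
  \<open>q\<close>, and pulling a point of the attractor back along it yields the required
  point.\<close>

lemma rect_code_meets_K_dual:
  assumes "c \<in> rect_codes p q" "p \<le> q"
  shows "\<exists>P\<in>K_dual m n \<Lambda>. meets_rect p q P c"
proof -
  obtain w s where w: "set w \<subseteq> \<Lambda>" "length w = p" and s: "set s \<subseteq> snd ` \<Lambda>" "length s = q - p"
    and c: "c = (digit_value m (map fst w), digit_value n (s @ map snd w))"
    using assms(1) by (auto simp: rect_codes_def lists_of_def)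
  have "s \<in> lists (snd ` \<Lambda>)" using s(1) by auto
  then obtain v where v: "s = map snd v" "set v \<subseteq> \<Lambda>"
    unfolding lists_image by blast
  obtain kx ky where k: "(kx, ky) \<in> K_dual m n \<Lambda>" using K_dual_nonempty by auto
  define P where "P = ((kx - of_int (digit_value m (map fst (v @ w)))) / real m ^ q,
    (ky - of_int (digit_value n (map snd (v @ w)))) / real n ^ q)"
  have len: "length (v @ w) = q" using w s v assms(2) by simp
  have img: "word_map m n (v @ w) P = (kx, ky)"
    unfolding P_def word_map_apply len using m_ge_2 n_ge_2 by simp
  have "v @ w \<in> lists_of \<Lambda> q" using v w len by (auto simp: lists_of_def)
  then have "P \<in> K_dual m n \<Lambda>"
    using K_dual_iff_word[of P q] img k by metis
  moreover have "meets_rect p q P c"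
    unfolding c v(1)
    using img k K_dual_subset v s w assms(2) by (intro meets_rect_of_word) auto
  ultimately show ?thesis by blast
qed

end

section \<open>Comparison of mesh squares with coded rectangles\<close>

lemma card_le_of_relation:
  assumes "finite A" and "\<And>b. b \<in> B \<Longrightarrow> \<exists>a\<in>A. b \<in> R a"
    and "\<And>a. a \<in> A \<Longrightarrow> finite (R a) \<and> card (R a) \<le> c"
  shows "finite B" "card B \<le> card A * c"
proof -
  have sub: "B \<subseteq> (\<Union>a\<in>A. R a)" and fin: "finite (\<Union>a\<in>A. R a)"
    using assms by blast+
  then show "finite B" by (rule finite_subset)
  have "card B \<le> card (\<Union>a\<in>A. R a)" by (rule card_mono[OF fin sub])
  also have "\<dots> \<le> (\<Sum>a\<in>A. card (R a))" by (rule card_UN_le[OF assms(1)])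
  also have "\<dots> \<le> card A * c"
    using sum_bounded_above[of A "\<lambda>a. card (R a)" c] assms(3) by simp
  finally show "card B \<le> card A * c" .
qed

definition int_box :: "real \<Rightarrow> real \<Rightarrow> (int \<times> int) set" where
  "int_box s t = {a. s - 2 \<le> of_int a \<and> of_int a \<le> s} \<times> {b. t - 2 \<le> of_int b \<and> of_int b \<le> t}"

lemma int_box: "finite (int_box s t) \<and> card (int_box s t) \<le> 9"
  unfolding int_box_def using card_int_interval_le[of s] card_int_interval_le[of t]
    mult_mono[OF card_int_interval_le(2)[of s] card_int_interval_le(2)[of t]]
  by (simp add: card_cartesian_product)

context digit_system
begin

abbreviation mesh_codes :: "real \<Rightarrow> (int \<times> int) set" where
  "mesh_codes \<delta> \<equiv> {(a, b).
     cbox (\<delta> * of_int a, \<delta> * of_int b) (\<delta> * (of_int a + 1), \<delta> * (of_int b + 1)) \<inter> K_dual m n \<Lambda> \<noteq> {}}"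

text \<open>The interval coded by \<open>a\<close> has length \<open>1 / M\<close>, at most the mesh
  width \<open>\<delta>\<close>, so a mesh interval meeting it has one of three indices. In
  \<open>rect_code_in_box\<close> the two lengths compare the other way round.\<close>

lemma mesh_code_in_box:
  fixes M \<delta> x :: real and a \<alpha> :: int
  assumes "0 < \<delta>" "1 \<le> \<delta> * M" "M * x + of_int a \<in> {-1..0}"
    "\<delta> * of_int \<alpha> \<le> x" "x \<le> \<delta> * (of_int \<alpha> + 1)"
  shows "- of_int a / (\<delta> * M) - 2 \<le> of_int \<alpha>" "of_int \<alpha> \<le> - of_int a / (\<delta> * M)"
proof -
  have M: "0 < M" using assms(1,2) by (smt (verit) zero_less_mult_iff)
  have "M * (\<delta> * of_int \<alpha>) \<le> M * x" "M * x \<le> M * (\<delta> * (of_int \<alpha> + 1))"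
    using assms(4,5) M by simp_all
  then have "\<delta> * M * of_int \<alpha> \<le> - of_int a" "- of_int a - 1 \<le> \<delta> * M * (of_int \<alpha> + 1)"
    using assms(3) by (simp_all add: algebra_simps)
  then show "- of_int a / (\<delta> * M) - 2 \<le> of_int \<alpha>" "of_int \<alpha> \<le> - of_int a / (\<delta> * M)"
    using assms(1,2) M by (simp_all add: field_simps)
qed

lemma rect_code_in_box:
  fixes M \<delta> x :: real and a \<alpha> :: int
  assumes "0 \<le> M" "\<delta> * M \<le> 1" "M * x + of_int a \<in> {-1..0}"
    "\<delta> * of_int \<alpha> \<le> x" "x \<le> \<delta> * (of_int \<alpha> + 1)"
  shows "- (\<delta> * M * of_int \<alpha>) - 2 \<le> of_int a" "of_int a \<le> - (\<delta> * M * of_int \<alpha>)"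
proof -
  have "M * (\<delta> * of_int \<alpha>) \<le> M * x" "M * x \<le> M * (\<delta> * (of_int \<alpha> + 1))"
    using assms(1,4,5) by (auto intro: mult_left_mono)
  then show "- (\<delta> * M * of_int \<alpha>) - 2 \<le> of_int a" "of_int a \<le> - (\<delta> * M * of_int \<alpha>)"
    using assms(2,3) by (simp_all add: algebra_simps)
qed

text \<open>Every coded rectangle has sides at most \<open>\<delta>\<close> and so meets at most
  \<open>3 * 3\<close> mesh squares. Finiteness is stated separately because
  \<open>box_count\<close> is a cardinality, which would be \<open>0\<close> for an infinite
  set.\<close>

lemma box_count_upper:
  assumes "0 < \<delta>" "p \<le> q" "1 \<le> \<delta> * real m ^ p" "1 \<le> \<delta> * real n ^ q"
  shows "finite (mesh_codes \<delta>)"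
    and "box_count (K_dual m n \<Lambda>) \<delta> \<le> card \<Lambda> ^ p * card (snd ` \<Lambda>) ^ (q - p) * 9"
proof -
  define R where "R = (\<lambda>(a, b). int_box (- of_int a / (\<delta> * real m ^ p)) (- of_int b / (\<delta> * real n ^ q)))"
  have ex: "\<exists>c\<in>rect_codes p q. d \<in> R c" if mesh: "d \<in> mesh_codes \<delta>" for d
  proof -
    obtain \<alpha> \<beta> x y where d: "d = (\<alpha>, \<beta>)" "(x, y) \<in> K_dual m n \<Lambda>"
      "\<delta> * of_int \<alpha> \<le> x" "x \<le> \<delta> * (of_int \<alpha> + 1)" "\<delta> * of_int \<beta> \<le> y" "y \<le> \<delta> * (of_int \<beta> + 1)"
      using mesh by (force simp: cbox_Pair_eq)
    obtain a b where ab: "(a, b) \<in> rect_codes p q" "meets_rect p q (x, y) (a, b)"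
      using K_dual_point_meets_rect[OF d(2) assms(2)] by auto
    then have "d \<in> R (a, b)"
      using mesh_code_in_box[OF assms(1,3), of x a \<alpha>] mesh_code_in_box[OF assms(1,4), of y b \<beta>] d
      by (simp add: R_def int_box_def meets_rect_def)
    with ab(1) show ?thesis by blast
  qed
  have R: "finite (R c) \<and> card (R c) \<le> 9" for c
    by (simp add: R_def int_box split: prod.split)
  note bound = card_le_of_relation[OF finite_rect_codes ex R]
  show "finite (mesh_codes \<delta>)" by (rule bound(1))
  show "box_count (K_dual m n \<Lambda>) \<delta> \<le> card \<Lambda> ^ p * card (snd ` \<Lambda>) ^ (q - p) * 9"
    unfolding box_count_def using bound(2) by (simp only: card_rect_codes)
qed

lemma box_count_lower:
  assumes "0 < \<delta>" "p \<le> q" "\<delta> * real m ^ p \<le> 1" "\<delta> * real n ^ q \<le> 1"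
    and fin: "finite (mesh_codes \<delta>)"
  shows "card \<Lambda> ^ p * card (snd ` \<Lambda>) ^ (q - p) \<le> box_count (K_dual m n \<Lambda>) \<delta> * 9"
proof -
  define R where "R = (\<lambda>(\<alpha>, \<beta>). int_box (- (\<delta> * real m ^ p * of_int \<alpha>)) (- (\<delta> * real n ^ q * of_int \<beta>)))"
  have ex: "\<exists>d\<in>mesh_codes \<delta>. c \<in> R d" if c: "c \<in> rect_codes p q" for c
  proof -
    obtain a b where ab: "c = (a, b)" by (cases c)
    obtain x y where xy: "(x, y) \<in> K_dual m n \<Lambda>" "meets_rect p q (x, y) (a, b)"
      using rect_code_meets_K_dual[OF c assms(2)] ab by auto
    have floor: "\<delta> * of_int \<lfloor>z / \<delta>\<rfloor> \<le> z" "z \<le> \<delta> * (of_int \<lfloor>z / \<delta>\<rfloor> + 1)" for z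
    proof -
      have "of_int \<lfloor>z / \<delta>\<rfloor> \<le> z / \<delta>" "z / \<delta> \<le> of_int \<lfloor>z / \<delta>\<rfloor> + 1" by linarith+
      then have "\<delta> * of_int \<lfloor>z / \<delta>\<rfloor> \<le> \<delta> * (z / \<delta>)" "\<delta> * (z / \<delta>) \<le> \<delta> * (of_int \<lfloor>z / \<delta>\<rfloor> + 1)"
        using less_imp_le[OF assms(1)] by (blast intro: mult_left_mono)+
      moreover have "\<delta> * (z / \<delta>) = z" using assms(1) by simp
      ultimately show "\<delta> * of_int \<lfloor>z / \<delta>\<rfloor> \<le> z" "z \<le> \<delta> * (of_int \<lfloor>z / \<delta>\<rfloor> + 1)"
        by (simp_all only:)
    qed
    \<comment> \<open>A point of the attractor in the rectangle selects the mesh square that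
      contains it.\<close>
    have "(\<lfloor>x / \<delta>\<rfloor>, \<lfloor>y / \<delta>\<rfloor>) \<in> mesh_codes \<delta>"
    proof -
      have "(x, y) \<in> cbox (\<delta> * of_int \<lfloor>x / \<delta>\<rfloor>, \<delta> * of_int \<lfloor>y / \<delta>\<rfloor>)
          (\<delta> * (of_int \<lfloor>x / \<delta>\<rfloor> + 1), \<delta> * (of_int \<lfloor>y / \<delta>\<rfloor> + 1))"
        using floor by (simp add: cbox_Pair_eq)
      then show ?thesis using xy(1) by blast
    qed
    moreover have "c \<in> R (\<lfloor>x / \<delta>\<rfloor>, \<lfloor>y / \<delta>\<rfloor>)"
      using rect_code_in_box[OF _ assms(3), of x a] rect_code_in_box[OF _ assms(4), of y b]
        xy(2) floor
      by (simp add: R_def int_box_def meets_rect_def ab)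
    ultimately show ?thesis by blast
  qed
  have R: "finite (R c) \<and> card (R c) \<le> 9" for c
    by (simp add: R_def int_box split: prod.split)
  show ?thesis
    unfolding box_count_def using card_le_of_relation(2)[where B = "rect_codes p q", OF fin ex R]
    by (simp only: card_rect_codes)
qed

lemma box_quotient_tendsto:
  "(box_quotient (K_dual m n \<Lambda>) \<longlongrightarrow> carpet_dim m n (card \<Lambda>) (card (snd ` \<Lambda>))) (at_right 0)"
proof -
  let ?K = "K_dual m n \<Lambda>" and ?C = "card (snd ` \<Lambda>)"
  have C: "1 \<le> ?C"
    by (rule card_rows_ge_1)
  have bounds: "square_count m n (card \<Lambda>) ?C h \<le> 9 * real (box_count ?K (inverse h))"
    "real (box_count ?K (inverse h)) \<le> 9 * real (card \<Lambda>) * square_count m n (card \<Lambda>) ?C h"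
    if h: "1 \<le> h" for h
  proof -
    let ?p = "nat_log m h" and ?q = "nat_log n h"
    have pq: "?p \<le> ?q" by (rule nat_log_antimono_base[OF n_ge_2 n_le_m h])
    have pos: "0 < inverse h" using h by simp
    have lo: "inverse h * real m ^ ?p \<le> 1" "inverse h * real n ^ ?q \<le> 1"
      using power_nat_log_le[OF m_ge_2 h] power_nat_log_le[OF n_ge_2 h] h
      by (simp_all add: field_simps)
    have up: "1 \<le> inverse h * real m ^ Suc ?p" "1 \<le> inverse h * real n ^ Suc ?q"
      using less_power_Suc_nat_log[OF m_ge_2 h] less_power_Suc_nat_log[OF n_ge_2 h] h
      by (simp_all add: field_simps)
    note upper = box_count_upper[OF pos Suc_le_mono[THEN iffD2, OF pq] up]
    have "real (card \<Lambda> ^ ?p * ?C ^ (?q - ?p)) \<le> real (box_count ?K (inverse h) * 9)"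
      using box_count_lower[OF pos pq lo upper(1)] by (rule of_nat_mono)
    then show "square_count m n (card \<Lambda>) ?C h \<le> 9 * real (box_count ?K (inverse h))"
      by (simp add: square_count_def)
    have "real (box_count ?K (inverse h)) \<le> real (card \<Lambda> ^ Suc ?p * ?C ^ (Suc ?q - Suc ?p) * 9)"
      using upper(2) by (rule of_nat_mono)
    then show "real (box_count ?K (inverse h)) \<le> 9 * real (card \<Lambda>) * square_count m n (card \<Lambda>) ?C h"
      using square_count_Suc[of "card \<Lambda>" m h ?C n] by (simp add: square_count_def)
  qed
  have "((\<lambda>h. ln (real (box_count ?K (inverse h))) / ln h) \<longlongrightarrow> carpet_dim m n (card \<Lambda>) ?C) at_top"
  proof (rule ln_count_tendsto[where a = "1 / 9" and A = "9 * real (card \<Lambda>)" and c = 1 and d = 1])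
    show "\<forall>\<^sub>F h in at_top. 1 / 9 * square_count m n (card \<Lambda>) ?C (1 * h) \<le> real (box_count ?K (inverse h))"
      using eventually_ge_at_top[of 1] by eventually_elim (use bounds(1) in fastforce)
    show "\<forall>\<^sub>F h in at_top. real (box_count ?K (inverse h))
      \<le> 9 * real (card \<Lambda>) * (1 + real (nat_log n (1 * h))) * square_count m n (card \<Lambda>) ?C (1 * h)"
      using eventually_ge_at_top[of 1]
    proof eventually_elim
      case (elim h)
      \<comment> \<open>No logarithmic loss occurs here; the factor, at least \<open>1\<close>, is
        inserted to match the form of \<open>ln_count_tendsto\<close>.\<close>
      have "9 * real (card \<Lambda>) * square_count m n (card \<Lambda>) ?C h
        \<le> 9 * real (card \<Lambda>) * (1 + real (nat_log n h)) * square_count m n (card \<Lambda>) ?C h"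
        using square_count_pos[OF card_Lambda_ge_1 C, of m n h]
        by (intro mult_right_mono) (auto simp: algebra_simps)
      then show ?case using bounds(2)[OF elim] by simp
    qed
  qed (use n_ge_2 n_le_m card_Lambda_ge_1 C in auto)
  then show ?thesis
    \<comment> \<open>The substitution of \<open>inverse h\<close> for the mesh width turns the
      limit at \<open>0\<close> into one at infinity.\<close>
    unfolding filterlim_at_right_to_top
  proof (rule Lim_transform_eventually)
    show "\<forall>\<^sub>F h in at_top. ln (real (box_count ?K (inverse h))) / ln h = box_quotient ?K (inverse h)"
      using eventually_gt_at_top[of 0] by eventually_elim (simp add: box_quotient_def ln_inverse)
  qed
qed

section \<open>The affinity dimension\<close>

text \<open>The pressure is affine on each side of \<open>1\<close>. If its zero is at most
  \<open>1\<close>, \<open>?C \<le> ?N\<close> gives the inequality; beyond \<open>1\<close>,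
  \<open>?C \<le> n\<close> does.\<close>

lemma carpet_dim_le_s_aff: "carpet_dim m n (card \<Lambda>) (card (snd ` \<Lambda>)) \<le> s_aff m n \<Lambda>"
  and s_aff_conformal: "m = n \<Longrightarrow> s_aff m n \<Lambda> = log (real m) (real (card \<Lambda>))"
proof -
  let ?N = "card \<Lambda>" and ?C = "card (snd ` \<Lambda>)"
  define L a b where "L = ln (real ?N)" and "a = ln (real m)" and "b = ln (real n)"
  have ab: "0 < b" "b \<le> a" using n_ge_2 n_le_m by (auto simp: a_def b_def)
  have N: "1 \<le> ?N" by (rule card_Lambda_ge_1)
  have L0: "0 \<le> L" using N by (simp add: L_def)
  have "?N \<le> card ({0..<m} \<times> {0..<n})" by (rule card_mono[OF _ digits]) simp
  then have "real ?N \<le> real m * real n"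
    by (simp add: card_cartesian_product flip: of_nat_mult)
  then have "L \<le> ln (real m * real n)" unfolding L_def using N by (intro ln_mono) auto
  then have Lab: "L \<le> a + b" using m_ge_2 n_ge_2 by (simp add: a_def b_def ln_mult)
  have C1: "1 \<le> ?C"
    by (rule card_rows_ge_1)
  have CN: "?C \<le> ?N" using finite_Lambda by (rule card_image_le)
  have "?C \<le> card {0..<n}" using digits by (intro card_mono) auto
  then have Cn: "ln (real ?C) \<le> b" and CL: "ln (real ?C) \<le> L"
    using C1 CN by (auto simp: b_def L_def)
  have pressure: "sv_pressure m n \<Lambda> s = (if s \<le> 1 then L - s * b else L - b + (1 - s) * a)" for s
    using m_ge_2 n_ge_2
    by (simp add: sv_pressure_def sv_fun_def L_def a_def b_def ln_powr ln_mult ln_inverse)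
  \<comment> \<open>The zeros of the two affine branches; \<open>L \<le> a + b\<close> keeps the
    second at most \<open>2\<close>.\<close>
  define s where "s = (if L \<le> b then L / b else 1 + (L - b) / a)"
  have s: "0 \<le> s \<and> s \<le> 2 \<and> sv_pressure m n \<Lambda> s = 0"
    unfolding pressure s_def using ab L0 Lab by (auto simp: field_simps)
  moreover have "t = s" if "0 \<le> t \<and> t \<le> 2 \<and> sv_pressure m n \<Lambda> t = 0" for t
  proof (cases "t \<le> 1")
    case True
    then have tb: "L = t * b" using that by (simp add: pressure)
    then have "L \<le> 1 * b" using True ab by (metis mult_right_mono less_imp_le)
    then show ?thesis using tb ab by (simp add: s_def)
  next
    case False
    then have ta: "L - b = (t - 1) * a" using that by (simp add: pressure algebra_simps)
    moreover have "0 < (t - 1) * a" using False ab by simp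
    ultimately show ?thesis using ab by (simp add: s_def)
  qed
  ultimately have eq: "s_aff m n \<Lambda> = s"
    unfolding s_aff_def by (rule the_equality)
  have inv: "0 \<le> 1 / b - 1 / a" using ab by (simp add: field_simps)
  show "carpet_dim m n ?N ?C \<le> s_aff m n \<Lambda>"
  proof (cases "L \<le> b")
    case True
    have "ln (real ?C) * (1 / b - 1 / a) \<le> L * (1 / b - 1 / a)"
      by (rule mult_right_mono[OF CL inv])
    then show ?thesis
      unfolding eq carpet_dim_def s_def using True by (simp add: L_def a_def b_def algebra_simps)
  next
    case False
    have "ln (real ?C) * (1 / b - 1 / a) \<le> b * (1 / b - 1 / a)"
      by (rule mult_right_mono[OF Cn inv])
    also have "\<dots> = 1 - b / a" using ab by (simp add: algebra_simps)
    finally show ?thesis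
      unfolding eq carpet_dim_def s_def using False
      by (simp add: L_def a_def b_def diff_divide_distrib)
  qed
  show "s_aff m n \<Lambda> = log (real m) (real ?N)" if "m = n"
    unfolding eq s_def log_def using that ab by (simp add: L_def a_def b_def diff_divide_distrib)
qed

end

section \<open>The chain of dimensions and the conformal case\<close>

theorem proposition9p3:
  fixes m n :: nat and \<Lambda> :: "(nat \<times> nat) set" and u v :: int
  assumes "2 \<le> n" and "n \<le> m"
    and "\<Lambda> \<subseteq> {0..<m} \<times> {0..<n}" and "\<Lambda> \<noteq> {}"
  shows "(growth_quotient m n \<Lambda> \<longlongrightarrow> growth_dim m n \<Lambda>) at_top
    \<and> (minkowski_quotient (forward_orbit m n \<Lambda> (of_int u, of_int v))
        \<longlongrightarrow> minkowski_dim (forward_orbit m n \<Lambda> (of_int u, of_int v))) at_top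
    \<and> (box_quotient (K_dual m n \<Lambda>) \<longlongrightarrow> box_dim (K_dual m n \<Lambda>)) (at_right 0)
    \<and> growth_dim m n \<Lambda> \<le> minkowski_dim (forward_orbit m n \<Lambda> (of_int u, of_int v))
    \<and> ereal (minkowski_dim (forward_orbit m n \<Lambda> (of_int u, of_int v)))
        \<le> beurling_dim (forward_orbit m n \<Lambda> (of_int u, of_int v))
    \<and> beurling_dim (forward_orbit m n \<Lambda> (of_int u, of_int v)) \<le> ereal (box_dim (K_dual m n \<Lambda>))
    \<and> box_dim (K_dual m n \<Lambda>) \<le> s_aff m n \<Lambda>
    \<and> (m = n \<longrightarrow>
         growth_dim m n \<Lambda> = log (real m) (real (card \<Lambda>))
       \<and> minkowski_dim (forward_orbit m n \<Lambda> (of_int u, of_int v)) = log (real m) (real (card \<Lambda>))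
       \<and> beurling_dim (forward_orbit m n \<Lambda> (of_int u, of_int v)) = ereal (log (real m) (real (card \<Lambda>)))
       \<and> box_dim (K_dual m n \<Lambda>) = log (real m) (real (card \<Lambda>))
       \<and> s_aff m n \<Lambda> = log (real m) (real (card \<Lambda>)))"
proof -
  interpret digit_system m n \<Lambda>
    using assms by unfold_locales
  \<comment> \<open>The proved limits identify each \<open>Lim\<close>, reducing the chain to values
    of \<open>carpet_dim\<close>.\<close>
  have growth: "growth_dim m n \<Lambda> = carpet_dim m n (card \<Lambda>) 1"
    unfolding growth_dim_def using growth_quotient_tendsto by (intro tendsto_Lim) auto
  have mink: "minkowski_dim (forward_orbit m n \<Lambda> (of_int u, of_int v))
      = carpet_dim m n (card \<Lambda>) (column_size u)"
    unfolding minkowski_dim_def using minkowski_quotient_tendsto by (intro tendsto_Lim) auto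
  have box: "box_dim (K_dual m n \<Lambda>) = carpet_dim m n (card \<Lambda>) (card (snd ` \<Lambda>))"
    unfolding box_dim_def using box_quotient_tendsto by (intro tendsto_Lim) auto
  \<comment> \<open>For equal bases the coefficient of \<open>ln C\<close> vanishes, so all choices
    of \<open>C\<close> agree.\<close>
  have conformal: "carpet_dim m n (card \<Lambda>) C = log (real m) (real (card \<Lambda>))" if "m = n" for C
    using that by (simp add: carpet_dim_def log_def)
  have le: "carpet_dim m n (card \<Lambda>) 1 \<le> carpet_dim m n (card \<Lambda>) (column_size u)"
    using assms(1,2) by (intro carpet_dim_mono) (auto simp: column_size_def)
  show ?thesis
    unfolding growth mink box
    using growth_quotient_tendsto minkowski_quotient_tendsto[of u v] box_quotient_tendsto le
      beurling_dim_bounds[of u v] carpet_dim_le_s_aff s_aff_conformal conformal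
    by (auto intro: antisym)
qed

end
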